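(* Let $\mathcal C$ be a Markov category and let $(\pi,\tau)\colon(Q_L,L)\to(Q_H,H)$ be a downward abstraction in $\mathcal C$, where each query $Q$ of $Q_H$ comes with a chosen sublist $Z_Q$ of its inputs, and suppose that $\tau$ is surjective. Then, setting $Z_{\pi(Q)}:=\pi(Z_Q)$ for each query $Q$ of $Q_H$, one obtains an upward abstraction $(Q_L^{\mathrm{Sh}},L)\to(Q_H^{\mathrm{Sh}},H)$, with the same type alignment $(\pi,\tau)$, via $$\omega\big(\pi(Q),s\big):=\big(Q,\ \tau\circ s\big)$$ for each query $Q$ of $Q_H$ and each sharp state $s$ of $\pi(Z_Q)$.
   Context: **Categories.** A Markov category is a symmetric monoidal category with terminal unit $I$ in which each object has a commutative comonoid structure (copy, discard) compatible with $\otimes$. Morphisms are called channels; $f$ is deterministic if $\mathrm{copy}\circ f=(f\otimes f)\circ\mathrm{copy}$; a sharp state of $A$ is a deterministic morphism $I\to A$. Functors are strong symmetric monoidal, copy-preserving, with deterministic structure isomorphisms; natural transformations are monoidal with deterministic components; "epic" means all components are epic. **Queries.** A query signature $Q$ is a set of objects (types) and a set of generators (queries), each with finite lists of input and output types; it freely generates a Markov category $\mathbf Q$ (objects: lists of types; morphisms: string diagrams). $(Q,M)$ denotes a query signature with a model $M$ of it, i.e. a functor $[\![-]\!]_M\colon\mathbf Q\to\mathcal C$. States "of a list of types" mean states of its image under $[\![-]\!]_M$. **The signature $Q^{\mathrm{Sh}}$.** If each query $q$ of $Q$ comes with a chosen sublist $Z_q$ of its inputs, $Q^{\mathrm{Sh}}$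 has the same types as $Q$ and a query $(q,s)$ for each query $q$ of $Q$ and each sharp state $s$ of $Z_q$; its inputs are the inputs of $q$ other than $Z_q$, its outputs those of $q$, and $[\![(q,s)]\!]_M$ is $[\![q]\!]_M$ with $s$ plugged into the inputs $Z_q$. (In the claim, queries of $Q_L$ not of the form $\pi(Q)$ play no role, as $\omega$ is only a partial map.) **Abstractions.** A type alignment $(\pi,\tau)\colon(Q_L,L)\to(Q_H,H)$ assigns to each type $X$ of $Q_H$ a list $\pi(X)$ of types of $Q_L$ and an epic deterministic channel $\tau_X\colon[\![\pi(X)]\!]_L\to[\![X]\!]_H$; it is extended to lists by concatenation and tensor product, and all such tensor products are also required to be epic. $\tau$ is surjective if for every type $X$ of $Q_H$ every sharp state of $[\![X]\!]_H$ is of the form $\tau_X\circ s$ for some sharp state $s$ of $[\![\pi(X)]\!]_L$. A downward abstraction $(\pi,\tau)\colon(Q_L,L)\to(Q_H,H)$ is a functor $\pi\colon\mathbf Q_H\to\mathbf Q_L$ sending each query of $Q_H$ to a query (generator) of $Q_L$, and an epic natural transformation $\tau\colon[\![-]\!]_L\circ\pi\Rightarrow[\![-]\!]_H$ (in particular it includes a type alignment). An upward abstraction $(\pi,\tau,\omega)\colon(Q_L,L)\to(Q_H,H)$ is a type alignment $(\pi,\tau)$ together with a partial surjective map $\omega$ from queries of $Q_L$ to queries of $Q_H$ such that whenever $\omega(q_L)=q_H\colon X\to Y$ is defined, $q_L$ has type $\pi(X)\to\pi(Y)$ and $\tau_Y\circ[\![q_L]\!]_L=[\![q_H]\!]_H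\circ\tau_X$.
   Formalization: The formal statement assumes that ω is well defined (single-valued) and that Z_{π(Q)} := π(Z_Q) is consistent, which can fail if π sends two queries of Q_H to the same query of Q_L; π is taken to act on lists strictly by concatenation. *)

theory Defs
  imports Main
begin

section \<open>Markov categories\<close>

record ('o, 'm) markov_cat =
  Obj :: "'o set"
  Arr :: "'m set"
  Dom :: "'m \<Rightarrow> 'o"
  Cod :: "'m \<Rightarrow> 'o"
  Ident :: "'o \<Rightarrow> 'm"
  Comp :: "'m \<Rightarrow> 'm \<Rightarrow> 'm"  (infixl \<open>\<cdot>\<index>\<close> 65)
  TensO :: "'o \<Rightarrow> 'o \<Rightarrow> 'o"  (infixr \<open>\<odot>\<index>\<close> 70)
  TensA :: "'m \<Rightarrow> 'm \<Rightarrow> 'm"  (infixr \<open>\<otimes>\<index>\<close> 70)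
  UnitO :: "'o"
  Assoc :: "'o \<Rightarrow> 'o \<Rightarrow> 'o \<Rightarrow> 'm"
  LUnit :: "'o \<Rightarrow> 'm"
  RUnit :: "'o \<Rightarrow> 'm"
  Swap :: "'o \<Rightarrow> 'o \<Rightarrow> 'm"
  Copy :: "'o \<Rightarrow> 'm"
  Discard :: "'o \<Rightarrow> 'm"

definition Hom :: "('o, 'm) markov_cat \<Rightarrow> 'o \<Rightarrow> 'o \<Rightarrow> 'm set" where
  "Hom C X Y = {f \<in> Arr C. Dom C f = X \<and> Cod C f = Y}"

definition inverse_arrows :: "('o, 'm) markov_cat \<Rightarrow> 'm \<Rightarrow> 'm \<Rightarrow> bool" where
  "inverse_arrows C f g \<longleftrightarrow>
     f \<in> Arr C \<and> g \<in> Hom C (Cod C f) (Dom C f) \<and>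
     Comp C g f = Ident C (Dom C f) \<and> Comp C f g = Ident C (Cod C f)"

definition iso :: "('o, 'm) markov_cat \<Rightarrow> 'm \<Rightarrow> bool" where
  "iso C f \<longleftrightarrow> (\<exists>g. inverse_arrows C f g)"

definition Inv :: "('o, 'm) markov_cat \<Rightarrow> 'm \<Rightarrow> 'm" where
  "Inv C f = (THE g. inverse_arrows C f g)"

definition epic :: "('o, 'm) markov_cat \<Rightarrow> 'm \<Rightarrow> bool" where
  "epic C f \<longleftrightarrow> f \<in> Arr C \<and>
     (\<forall>Z g h. g \<in> Hom C (Cod C f) Z \<longrightarrow> h \<in> Hom C (Cod C f) Z \<longrightarrow>
        Comp C g f = Comp C h f \<longrightarrow> g = h)"

definition middle_swap :: "('o, 'm) markov_cat \<Rightarrow> 'o \<Rightarrow> 'o \<Rightarrow> 'm" where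
  \<comment> \<open>\<open>(X \<odot> X) \<odot> (Y \<odot> Y) \<rightarrow> (X \<odot> Y) \<odot> (X \<odot> Y)\<close>\<close>
  "middle_swap C X Y =
     Comp C (Inv C (Assoc C X Y (TensO C X Y)))
       (Comp C (TensA C (Ident C X)
                  (Comp C (Assoc C Y X Y)
                    (Comp C (TensA C (Swap C X Y) (Ident C Y))
                            (Inv C (Assoc C X Y Y)))))
               (Assoc C X X (TensO C Y Y)))"

locale category =
  fixes C :: "('o, 'm) markov_cat" (structure)
  assumes dom_obj: "f \<in> Arr C \<Longrightarrow> Dom C f \<in> Obj C"
    and cod_obj: "f \<in> Arr C \<Longrightarrow> Cod C f \<in> Obj C"
    and id_hom: "X \<in> Obj C \<Longrightarrow> Ident C X \<in> Hom C X X"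
    and comp_hom: "\<lbrakk>f \<in> Hom C X Y; g \<in> Hom C Y Z\<rbrakk> \<Longrightarrow> g \<cdot> f \<in> Hom C X Z"
    and id_left: "f \<in> Hom C X Y \<Longrightarrow> Ident C Y \<cdot> f = f"
    and id_right: "f \<in> Hom C X Y \<Longrightarrow> f \<cdot> Ident C X = f"
    and comp_assoc: "\<lbrakk>f \<in> Hom C W X; g \<in> Hom C X Y; h \<in> Hom C Y Z\<rbrakk> \<Longrightarrow>
          h \<cdot> g \<cdot> f = h \<cdot> (g \<cdot> f)"

locale symmetric_monoidal_category = category +
  assumes unit_obj: "UnitO C \<in> Obj C"
    and tens_obj: "\<lbrakk>X \<in> Obj C; Y \<in> Obj C\<rbrakk> \<Longrightarrow> X \<odot> Y \<in> Obj C"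
    and tens_hom: "\<lbrakk>f \<in> Hom C X Y; f' \<in> Hom C X' Y'\<rbrakk> \<Longrightarrow> f \<otimes> f' \<in> Hom C (X \<odot> X') (Y \<odot> Y')"
    and tens_id: "\<lbrakk>X \<in> Obj C; Y \<in> Obj C\<rbrakk> \<Longrightarrow> Ident C X \<otimes> Ident C Y = Ident C (X \<odot> Y)"
    and interchange:
      "\<lbrakk>f \<in> Hom C X Y; g \<in> Hom C Y Z; f' \<in> Hom C X' Y'; g' \<in> Hom C Y' Z'\<rbrakk> \<Longrightarrow>
         (g \<cdot> f) \<otimes> (g' \<cdot> f') = (g \<otimes> g') \<cdot> (f \<otimes> f')"
    and assoc_hom: "\<lbrakk>X \<in> Obj C; Y \<in> Obj C; Z \<in> Obj C\<rbrakk> \<Longrightarrow>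
         Assoc C X Y Z \<in> Hom C ((X \<odot> Y) \<odot> Z) (X \<odot> (Y \<odot> Z))"
    and assoc_iso: "\<lbrakk>X \<in> Obj C; Y \<in> Obj C; Z \<in> Obj C\<rbrakk> \<Longrightarrow> iso C (Assoc C X Y Z)"
    and assoc_natural:
      "\<lbrakk>f \<in> Hom C X X'; g \<in> Hom C Y Y'; h \<in> Hom C Z Z'\<rbrakk> \<Longrightarrow>
         Assoc C X' Y' Z' \<cdot> ((f \<otimes> g) \<otimes> h) = (f \<otimes> (g \<otimes> h)) \<cdot> Assoc C X Y Z"
    and lunit_hom: "X \<in> Obj C \<Longrightarrow> LUnit C X \<in> Hom C (UnitO C \<odot> X) X"
    and lunit_iso: "X \<in> Obj C \<Longrightarrow> iso C (LUnit C X)"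
    and lunit_natural: "f \<in> Hom C X Y \<Longrightarrow>
         LUnit C Y \<cdot> (Ident C (UnitO C) \<otimes> f) = f \<cdot> LUnit C X"
    and runit_hom: "X \<in> Obj C \<Longrightarrow> RUnit C X \<in> Hom C (X \<odot> UnitO C) X"
    and runit_iso: "X \<in> Obj C \<Longrightarrow> iso C (RUnit C X)"
    and runit_natural: "f \<in> Hom C X Y \<Longrightarrow>
         RUnit C Y \<cdot> (f \<otimes> Ident C (UnitO C)) = f \<cdot> RUnit C X"
    and pentagon: "\<lbrakk>W \<in> Obj C; X \<in> Obj C; Y \<in> Obj C; Z \<in> Obj C\<rbrakk> \<Longrightarrow>
         Assoc C W X (Y \<odot> Z) \<cdot> Assoc C (W \<odot> X) Y Z =
         (Ident C W \<otimes> Assoc C X Y Z) \<cdot> Assoc C W (X \<odot> Y) Z \<cdot> (Assoc C W X Y \<otimes> Ident C Z)"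
    and triangle: "\<lbrakk>X \<in> Obj C; Y \<in> Obj C\<rbrakk> \<Longrightarrow>
         (Ident C X \<otimes> LUnit C Y) \<cdot> Assoc C X (UnitO C) Y = RUnit C X \<otimes> Ident C Y"
    and swap_hom: "\<lbrakk>X \<in> Obj C; Y \<in> Obj C\<rbrakk> \<Longrightarrow> Swap C X Y \<in> Hom C (X \<odot> Y) (Y \<odot> X)"
    and swap_natural: "\<lbrakk>f \<in> Hom C X X'; g \<in> Hom C Y Y'\<rbrakk> \<Longrightarrow>
         Swap C X' Y' \<cdot> (f \<otimes> g) = (g \<otimes> f) \<cdot> Swap C X Y"
    and swap_swap: "\<lbrakk>X \<in> Obj C; Y \<in> Obj C\<rbrakk> \<Longrightarrow> Swap C Y X \<cdot> Swap C X Y = Ident C (X \<odot> Y)"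
    and hexagon: "\<lbrakk>X \<in> Obj C; Y \<in> Obj C; Z \<in> Obj C\<rbrakk> \<Longrightarrow>
         Assoc C Y Z X \<cdot> Swap C X (Y \<odot> Z) \<cdot> Assoc C X Y Z =
         (Ident C Y \<otimes> Swap C X Z) \<cdot> Assoc C Y X Z \<cdot> (Swap C X Y \<otimes> Ident C Z)"

text \<open>
  Terminality of the unit object is the axiom \<open>discard_unique\<close>; it forces
  discarding to be compatible with the tensor product.
\<close>

locale markov_category = symmetric_monoidal_category +
  assumes copy_hom: "X \<in> Obj C \<Longrightarrow> Copy C X \<in> Hom C X (X \<odot> X)"
    and discard_hom: "X \<in> Obj C \<Longrightarrow> Discard C X \<in> Hom C X (UnitO C)"
    and copy_assoc: "X \<in> Obj C \<Longrightarrow>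
         Assoc C X X X \<cdot> (Copy C X \<otimes> Ident C X) \<cdot> Copy C X = (Ident C X \<otimes> Copy C X) \<cdot> Copy C X"
    and copy_counit_left: "X \<in> Obj C \<Longrightarrow>
         LUnit C X \<cdot> (Discard C X \<otimes> Ident C X) \<cdot> Copy C X = Ident C X"
    and copy_counit_right: "X \<in> Obj C \<Longrightarrow>
         RUnit C X \<cdot> (Ident C X \<otimes> Discard C X) \<cdot> Copy C X = Ident C X"
    and copy_comm: "X \<in> Obj C \<Longrightarrow> Swap C X X \<cdot> Copy C X = Copy C X"
    and copy_tens: "\<lbrakk>X \<in> Obj C; Y \<in> Obj C\<rbrakk> \<Longrightarrow>
         Copy C (X \<odot> Y) = middle_swap C X Y \<cdot> (Copy C X \<otimes> Copy C Y)"
    and discard_unique: "f \<in> Hom C X (UnitO C) \<Longrightarrow> f = Discard C X"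

definition deterministic :: "('o, 'm) markov_cat \<Rightarrow> 'm \<Rightarrow> bool" where
  "deterministic C f \<longleftrightarrow> f \<in> Arr C \<and>
     Comp C (Copy C (Cod C f)) f = Comp C (TensA C f f) (Copy C (Dom C f))"

definition sharp_state :: "('o, 'm) markov_cat \<Rightarrow> 'o \<Rightarrow> 'm \<Rightarrow> bool" where
  "sharp_state C A s \<longleftrightarrow> s \<in> Hom C (UnitO C) A \<and> deterministic C s"


section \<open>Functors and natural transformations\<close>

record ('o1, 'm1, 'o2, 'm2) mfunctor =
  FObj :: "'o1 \<Rightarrow> 'o2"
  FArr :: "'m1 \<Rightarrow> 'm2"
  FMult :: "'o1 \<Rightarrow> 'o1 \<Rightarrow> 'm2"
  FUnit :: "'m2"

text \<open>
  Strong symmetric monoidal functors that preserve copying and have deterministic structure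
  isomorphisms \<open>F X \<odot> F Y \<rightarrow> F (X \<odot> Y)\<close> (\<open>FMult\<close>) and \<open>I \<rightarrow> F I\<close> (\<open>FUnit\<close>).
\<close>

locale markov_functor =
  fixes C :: "('o1, 'm1) markov_cat"
    and D :: "('o2, 'm2) markov_cat" (structure)
    and F :: "('o1, 'm1, 'o2, 'm2) mfunctor"
  assumes f_obj: "X \<in> Obj C \<Longrightarrow> FObj F X \<in> Obj D"
    and f_hom: "f \<in> Hom C X Y \<Longrightarrow> FArr F f \<in> Hom D (FObj F X) (FObj F Y)"
    and f_id: "X \<in> Obj C \<Longrightarrow> FArr F (Ident C X) = Ident D (FObj F X)"
    and f_comp: "\<lbrakk>f \<in> Hom C X Y; g \<in> Hom C Y Z\<rbrakk> \<Longrightarrow>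
          FArr F (Comp C g f) = FArr F g \<cdot> FArr F f"
    and mult_hom: "\<lbrakk>X \<in> Obj C; Y \<in> Obj C\<rbrakk> \<Longrightarrow>
          FMult F X Y \<in> Hom D (FObj F X \<odot> FObj F Y) (FObj F (TensO C X Y))"
    and mult_iso: "\<lbrakk>X \<in> Obj C; Y \<in> Obj C\<rbrakk> \<Longrightarrow> iso D (FMult F X Y)"
    and mult_det: "\<lbrakk>X \<in> Obj C; Y \<in> Obj C\<rbrakk> \<Longrightarrow> deterministic D (FMult F X Y)"
    and mult_natural: "\<lbrakk>f \<in> Hom C X X'; g \<in> Hom C Y Y'\<rbrakk> \<Longrightarrow>
          FArr F (TensA C f g) \<cdot> FMult F X Y = FMult F X' Y' \<cdot> (FArr F f \<otimes> FArr F g)"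
    and unit_hom: "FUnit F \<in> Hom D (UnitO D) (FObj F (UnitO C))"
    and unit_iso: "iso D (FUnit F)"
    and unit_det: "deterministic D (FUnit F)"
    and mult_assoc: "\<lbrakk>X \<in> Obj C; Y \<in> Obj C; Z \<in> Obj C\<rbrakk> \<Longrightarrow>
          FArr F (Assoc C X Y Z) \<cdot> FMult F (TensO C X Y) Z \<cdot> (FMult F X Y \<otimes> Ident D (FObj F Z)) =
          FMult F X (TensO C Y Z) \<cdot> (Ident D (FObj F X) \<otimes> FMult F Y Z) \<cdot>
            Assoc D (FObj F X) (FObj F Y) (FObj F Z)"
    and mult_lunit: "X \<in> Obj C \<Longrightarrow>
          FArr F (LUnit C X) \<cdot> FMult F (UnitO C) X \<cdot> (FUnit F \<otimes> Ident D (FObj F X)) =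
          LUnit D (FObj F X)"
    and mult_runit: "X \<in> Obj C \<Longrightarrow>
          FArr F (RUnit C X) \<cdot> FMult F X (UnitO C) \<cdot> (Ident D (FObj F X) \<otimes> FUnit F) =
          RUnit D (FObj F X)"
    and mult_swap: "\<lbrakk>X \<in> Obj C; Y \<in> Obj C\<rbrakk> \<Longrightarrow>
          FArr F (Swap C X Y) \<cdot> FMult F X Y = FMult F Y X \<cdot> Swap D (FObj F X) (FObj F Y)"
    and f_copy: "X \<in> Obj C \<Longrightarrow> FArr F (Copy C X) = FMult F X X \<cdot> Copy D (FObj F X)"

definition functor_comp ::
  "('o3, 'm3) markov_cat \<Rightarrow> ('o2, 'm2, 'o3, 'm3) mfunctor \<Rightarrow> ('o1, 'm1, 'o2, 'm2) mfunctor
    \<Rightarrow> ('o1, 'm1, 'o3, 'm3) mfunctor" where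
  \<comment> \<open>\<open>G \<circ> F\<close>; the category is the codomain of \<open>G\<close>\<close>
  "functor_comp E G F =
     \<lparr>FObj = (\<lambda>X. FObj G (FObj F X)),
      FArr = (\<lambda>f. FArr G (FArr F f)),
      FMult = (\<lambda>X Y. Comp E (FArr G (FMult F X Y)) (FMult G (FObj F X) (FObj F Y))),
      FUnit = Comp E (FArr G (FUnit F)) (FUnit G)\<rparr>"

locale markov_transformation =
  fixes C :: "('o1, 'm1) markov_cat"
    and D :: "('o2, 'm2) markov_cat" (structure)
    and F G :: "('o1, 'm1, 'o2, 'm2) mfunctor"
    and \<tau> :: "'o1 \<Rightarrow> 'm2"
  assumes component_hom: "X \<in> Obj C \<Longrightarrow> \<tau> X \<in> Hom D (FObj F X) (FObj G X)"
    and component_det: "X \<in> Obj C \<Longrightarrow> deterministic D (\<tau> X)"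
    and natural: "f \<in> Hom C X Y \<Longrightarrow> \<tau> Y \<cdot> FArr F f = FArr G f \<cdot> \<tau> X"
    and monoidal_mult: "\<lbrakk>X \<in> Obj C; Y \<in> Obj C\<rbrakk> \<Longrightarrow>
          \<tau> (TensO C X Y) \<cdot> FMult F X Y = FMult G X Y \<cdot> (\<tau> X \<otimes> \<tau> Y)"
    and monoidal_unit: "\<tau> (UnitO C) \<cdot> FUnit F = FUnit G"

definition epic_transformation where
  "epic_transformation C D F G \<tau> \<longleftrightarrow>
     markov_transformation C D F G \<tau> \<and> (\<forall>X\<in>Obj C. epic D (\<tau> X))"


section \<open>Query signatures and their free Markov categories\<close>

record ('t, 'q) qsig =
  qtypes :: "'t set"
  queries :: "'q set"
  qin :: "'q \<Rightarrow> 't list"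
  qout :: "'q \<Rightarrow> 't list"

definition query_signature :: "('t, 'q) qsig \<Rightarrow> bool" where
  "query_signature Q \<longleftrightarrow>
     (\<forall>q\<in>queries Q. qin Q q \<in> lists (qtypes Q) \<and> qout Q q \<in> lists (qtypes Q))"

text \<open>
  String diagrams are terms modulo the axioms of a strict Markov category whose objects are
  lists of types, with concatenation as tensor product.
\<close>

datatype ('t, 'q) diag =
    DGen 'q
  | DId "'t list"
  | DComp "('t, 'q) diag" "('t, 'q) diag"
  | DTens "('t, 'q) diag" "('t, 'q) diag"
  | DSwap "'t list" "'t list"
  | DCopy "'t list"
  | DDiscard "'t list"

primrec ddom :: "('t, 'q) qsig \<Rightarrow> ('t, 'q) diag \<Rightarrow> 't list" where
  "ddom Q (DGen q) = qin Q q"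
| "ddom Q (DId xs) = xs"
| "ddom Q (DComp g f) = ddom Q f"
| "ddom Q (DTens f g) = ddom Q f @ ddom Q g"
| "ddom Q (DSwap xs ys) = xs @ ys"
| "ddom Q (DCopy xs) = xs"
| "ddom Q (DDiscard xs) = xs"

primrec dcod :: "('t, 'q) qsig \<Rightarrow> ('t, 'q) diag \<Rightarrow> 't list" where
  "dcod Q (DGen q) = qout Q q"
| "dcod Q (DId xs) = xs"
| "dcod Q (DComp g f) = dcod Q g"
| "dcod Q (DTens f g) = dcod Q f @ dcod Q g"
| "dcod Q (DSwap xs ys) = ys @ xs"
| "dcod Q (DCopy xs) = xs @ xs"
| "dcod Q (DDiscard xs) = []"

primrec dwf :: "('t, 'q) qsig \<Rightarrow> ('t, 'q) diag \<Rightarrow> bool" where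
  "dwf Q (DGen q) \<longleftrightarrow> q \<in> queries Q"
| "dwf Q (DId xs) \<longleftrightarrow> xs \<in> lists (qtypes Q)"
| "dwf Q (DComp g f) \<longleftrightarrow> dwf Q g \<and> dwf Q f \<and> dcod Q f = ddom Q g"
| "dwf Q (DTens f g) \<longleftrightarrow> dwf Q f \<and> dwf Q g"
| "dwf Q (DSwap xs ys) \<longleftrightarrow> xs \<in> lists (qtypes Q) \<and> ys \<in> lists (qtypes Q)"
| "dwf Q (DCopy xs) \<longleftrightarrow> xs \<in> lists (qtypes Q)"
| "dwf Q (DDiscard xs) \<longleftrightarrow> xs \<in> lists (qtypes Q)"

inductive deq :: "('t, 'q) qsig \<Rightarrow> ('t, 'q) diag \<Rightarrow> ('t, 'q) diag \<Rightarrow> bool" for Q where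
  refl: "dwf Q f \<Longrightarrow> deq Q f f"
| sym: "deq Q f g \<Longrightarrow> deq Q g f"
| trans: "deq Q f g \<Longrightarrow> deq Q g h \<Longrightarrow> deq Q f h"
| comp_cong: "deq Q g g' \<Longrightarrow> deq Q f f' \<Longrightarrow> dcod Q f = ddom Q g \<Longrightarrow>
    deq Q (DComp g f) (DComp g' f')"
| tens_cong: "deq Q f f' \<Longrightarrow> deq Q g g' \<Longrightarrow> deq Q (DTens f g) (DTens f' g')"
| id_left: "dwf Q f \<Longrightarrow> deq Q (DComp (DId (dcod Q f)) f) f"
| id_right: "dwf Q f \<Longrightarrow> deq Q (DComp f (DId (ddom Q f))) f"
| comp_assoc: "dwf Q (DComp (DComp h g) f) \<Longrightarrow>
    deq Q (DComp (DComp h g) f) (DComp h (DComp g f))"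
| tens_id: "dwf Q (DTens (DId xs) (DId ys)) \<Longrightarrow>
    deq Q (DTens (DId xs) (DId ys)) (DId (xs @ ys))"
| interchange: "dwf Q (DComp g f) \<Longrightarrow> dwf Q (DComp g' f') \<Longrightarrow>
    deq Q (DTens (DComp g f) (DComp g' f')) (DComp (DTens g g') (DTens f f'))"
| tens_assoc: "dwf Q f \<Longrightarrow> dwf Q g \<Longrightarrow> dwf Q h \<Longrightarrow>
    deq Q (DTens (DTens f g) h) (DTens f (DTens g h))"
| tens_unit_left: "dwf Q f \<Longrightarrow> deq Q (DTens (DId []) f) f"
| tens_unit_right: "dwf Q f \<Longrightarrow> deq Q (DTens f (DId [])) f"
| swap_natural: "dwf Q f \<Longrightarrow> dwf Q g \<Longrightarrow>
    deq Q (DComp (DSwap (dcod Q f) (dcod Q g)) (DTens f g))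
          (DComp (DTens g f) (DSwap (ddom Q f) (ddom Q g)))"
| swap_swap: "dwf Q (DSwap xs ys) \<Longrightarrow>
    deq Q (DComp (DSwap ys xs) (DSwap xs ys)) (DId (xs @ ys))"
| hexagon: "dwf Q (DSwap xs (ys @ zs)) \<Longrightarrow>
    deq Q (DSwap xs (ys @ zs))
          (DComp (DTens (DId ys) (DSwap xs zs)) (DTens (DSwap xs ys) (DId zs)))"
| copy_assoc: "dwf Q (DCopy xs) \<Longrightarrow>
    deq Q (DComp (DTens (DCopy xs) (DId xs)) (DCopy xs))
          (DComp (DTens (DId xs) (DCopy xs)) (DCopy xs))"
| copy_counit_left: "dwf Q (DCopy xs) \<Longrightarrow>
    deq Q (DComp (DTens (DDiscard xs) (DId xs)) (DCopy xs)) (DId xs)"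
| copy_counit_right: "dwf Q (DCopy xs) \<Longrightarrow>
    deq Q (DComp (DTens (DId xs) (DDiscard xs)) (DCopy xs)) (DId xs)"
| copy_comm: "dwf Q (DCopy xs) \<Longrightarrow> deq Q (DComp (DSwap xs xs) (DCopy xs)) (DCopy xs)"
| copy_tens: "dwf Q (DCopy (xs @ ys)) \<Longrightarrow>
    deq Q (DCopy (xs @ ys))
          (DComp (DTens (DId xs) (DTens (DSwap xs ys) (DId ys))) (DTens (DCopy xs) (DCopy ys)))"
| discard_unique: "dwf Q f \<Longrightarrow> dcod Q f = [] \<Longrightarrow> deq Q f (DDiscard (ddom Q f))"

definition dclass :: "('t, 'q) qsig \<Rightarrow> ('t, 'q) diag \<Rightarrow> ('t, 'q) diag set" where
  "dclass Q d = {e. deq Q d e}"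

definition drep :: "('t, 'q) diag set \<Rightarrow> ('t, 'q) diag" where
  "drep c = (SOME d. d \<in> c)"

definition free_markov :: "('t, 'q) qsig \<Rightarrow> ('t list, ('t, 'q) diag set) markov_cat" where
  "free_markov Q =
     \<lparr>Obj = lists (qtypes Q),
      Arr = {dclass Q d | d. dwf Q d},
      Dom = (\<lambda>c. ddom Q (drep c)),
      Cod = (\<lambda>c. dcod Q (drep c)),
      Ident = (\<lambda>xs. dclass Q (DId xs)),
      Comp = (\<lambda>c c'. dclass Q (DComp (drep c) (drep c'))),
      TensO = (@),
      TensA = (\<lambda>c c'. dclass Q (DTens (drep c) (drep c'))),
      UnitO = [],
      Assoc = (\<lambda>xs ys zs. dclass Q (DId (xs @ ys @ zs))),
      LUnit = (\<lambda>xs. dclass Q (DId xs)),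
      RUnit = (\<lambda>xs. dclass Q (DId xs)),
      Swap = (\<lambda>xs ys. dclass Q (DSwap xs ys)),
      Copy = (\<lambda>xs. dclass Q (DCopy xs)),
      Discard = (\<lambda>xs. dclass Q (DDiscard xs))\<rparr>"

definition gen :: "('t, 'q) qsig \<Rightarrow> 'q \<Rightarrow> ('t, 'q) diag set" where
  "gen Q q = dclass Q (DGen q)"

type_synonym ('t, 'q, 'o, 'm) qmodel = "('t list, ('t, 'q) diag set, 'o, 'm) mfunctor"

definition model :: "('o, 'm) markov_cat \<Rightarrow> ('t, 'q) qsig \<Rightarrow> ('t, 'q, 'o, 'm) qmodel \<Rightarrow> bool" where
  "model C Q M \<longleftrightarrow> query_signature Q \<and> markov_functor (free_markov Q) C M"


section \<open>The signature of queries with sharp states plugged in\<close>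

text \<open>A sublist of a list of inputs is given by the set of its positions, as in \<^const>\<open>nths\<close>.\<close>

definition input_choice :: "('t, 'q) qsig \<Rightarrow> ('q \<Rightarrow> nat set) \<Rightarrow> bool" where
  "input_choice Q Z \<longleftrightarrow> (\<forall>q\<in>queries Q. Z q \<subseteq> {..<length (qin Q q)})"

text \<open>
  The permutation of wires \<open>nths xs (- Z) @ nths xs Z \<rightarrow> xs\<close> that keeps the order within both parts.
\<close>

fun unshuffle :: "'t list \<Rightarrow> nat set \<Rightarrow> ('t, 'q) diag" where
  "unshuffle [] Z = DId []"
| "unshuffle (x # xs) Z =
     (let Z' = {i. Suc i \<in> Z} in
      if 0 \<in> Z
      then DComp (DTens (DId [x]) (unshuffle xs Z'))
                 (DTens (DSwap (nths xs (- Z')) [x]) (DId (nths xs Z')))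
      else DTens (DId [x]) (unshuffle xs Z'))"

definition plug ::
  "('o, 'm) markov_cat \<Rightarrow> ('t, 'q) qsig \<Rightarrow> ('t, 'q, 'o, 'm) qmodel \<Rightarrow> ('q \<Rightarrow> nat set)
    \<Rightarrow> 'q \<times> 'm \<Rightarrow> 'm" where
  \<comment> \<open>\<open>M (nths X (- Z)) \<rightarrow> M (nths X (- Z)) \<odot> I \<rightarrow> M (nths X (- Z)) \<odot> M (nths X Z)
      \<rightarrow> M (nths X (- Z) @ nths X Z) \<rightarrow> M X \<rightarrow> M Y\<close> for a query from \<open>X\<close> to \<open>Y\<close>\<close>
  "plug C Q M Z = (\<lambda>(q, s).
     let xs = nths (qin Q q) (- Z q); zs = nths (qin Q q) (Z q) in
     Comp C (FArr M (gen Q q))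
       (Comp C (FArr M (dclass Q (unshuffle (qin Q q) (Z q))))
         (Comp C (FMult M xs zs)
           (Comp C (TensA C (Ident C (FObj M xs)) s)
             (Inv C (RUnit C (FObj M xs)))))))"

definition sh_sig ::
  "('o, 'm) markov_cat \<Rightarrow> ('t, 'q) qsig \<Rightarrow> ('t, 'q, 'o, 'm) qmodel \<Rightarrow> ('q \<Rightarrow> nat set)
    \<Rightarrow> ('t, 'q \<times> 'm) qsig" where
  "sh_sig C Q M Z =
     \<lparr>qtypes = qtypes Q,
      queries = {(q, s). q \<in> queries Q \<and> sharp_state C (FObj M (nths (qin Q q) (Z q))) s},
      qin = (\<lambda>(q, s). nths (qin Q q) (- Z q)),
      qout = (\<lambda>(q, s). qout Q q)\<rparr>"

text \<open>
  By freeness, a model is determined by its objects, its structure isomorphisms, and its values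
  on queries. Here the first two are those of a given \<open>M\<close> and the third is an arbitrary \<open>v\<close>,
  possibly for a different signature \<open>Q\<close> on the same types.
\<close>

primrec diag_value ::
  "('o, 'm) markov_cat \<Rightarrow> ('t list, 'a, 'o, 'm) mfunctor \<Rightarrow> ('t, 'q) qsig \<Rightarrow> ('q \<Rightarrow> 'm)
    \<Rightarrow> ('t, 'q) diag \<Rightarrow> 'm" where
  "diag_value C M Q v (DGen q) = v q"
| "diag_value C M Q v (DId xs) = Ident C (FObj M xs)"
| "diag_value C M Q v (DComp g f) = Comp C (diag_value C M Q v g) (diag_value C M Q v f)"
| "diag_value C M Q v (DTens f g) =
     Comp C (FMult M (dcod Q f) (dcod Q g))
       (Comp C (TensA C (diag_value C M Q v f) (diag_value C M Q v g))
               (Inv C (FMult M (ddom Q f) (ddom Q g))))"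
| "diag_value C M Q v (DSwap xs ys) =
     Comp C (FMult M ys xs)
       (Comp C (Swap C (FObj M xs) (FObj M ys)) (Inv C (FMult M xs ys)))"
| "diag_value C M Q v (DCopy xs) = Comp C (FMult M xs xs) (Copy C (FObj M xs))"
| "diag_value C M Q v (DDiscard xs) = Comp C (FUnit M) (Discard C (FObj M xs))"

definition sh_model ::
  "('o, 'm) markov_cat \<Rightarrow> ('t, 'q) qsig \<Rightarrow> ('t, 'q, 'o, 'm) qmodel \<Rightarrow> ('q \<Rightarrow> nat set)
    \<Rightarrow> ('t, 'q \<times> 'm, 'o, 'm) qmodel" where
  "sh_model C Q M Z =
     \<lparr>FObj = FObj M,
      FArr = (\<lambda>c. diag_value C M (sh_sig C Q M Z) (plug C Q M Z) (drep c)),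
      FMult = FMult M,
      FUnit = FUnit M\<rparr>"


section \<open>Abstractions\<close>

text \<open>
  The extension of an alignment on types to lists: \<open>\<tau> X\<^sub>1 \<otimes> \<dots> \<otimes> \<tau> X\<^sub>n\<close>, read as an arrow from the
  value of \<open>\<pi> X\<^sub>1 @ \<dots> @ \<pi> X\<^sub>n\<close> to that of \<open>[X\<^sub>1, \<dots>, X\<^sub>n]\<close>.
\<close>

primrec align_list ::
  "('o, 'm) markov_cat \<Rightarrow> ('u, 'r, 'o, 'm) qmodel \<Rightarrow> ('t, 'q, 'o, 'm) qmodel
    \<Rightarrow> ('t \<Rightarrow> 'u list) \<Rightarrow> ('t \<Rightarrow> 'm) \<Rightarrow> 't list \<Rightarrow> 'm" where
  "align_list C L H \<pi> \<tau> [] = Comp C (FUnit H) (Inv C (FUnit L))"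
| "align_list C L H \<pi> \<tau> (x # xs) =
     Comp C (FMult H [x] xs)
       (Comp C (TensA C (\<tau> x) (align_list C L H \<pi> \<tau> xs))
               (Inv C (FMult L (\<pi> x) (concat (map \<pi> xs)))))"

definition type_alignment ::
  "('o, 'm) markov_cat \<Rightarrow> ('u, 'r) qsig \<Rightarrow> ('u, 'r, 'o, 'm) qmodel
    \<Rightarrow> ('t, 'q) qsig \<Rightarrow> ('t, 'q, 'o, 'm) qmodel
    \<Rightarrow> ('t \<Rightarrow> 'u list) \<Rightarrow> ('t \<Rightarrow> 'm) \<Rightarrow> bool" where
  "type_alignment C QL L QH H \<pi> \<tau> \<longleftrightarrow>
     model C QL L \<and> model C QH H \<and>
     (\<forall>X\<in>qtypes QH. \<pi> X \<in> lists (qtypes QL) \<and>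
        \<tau> X \<in> Hom C (FObj L (\<pi> X)) (FObj H [X]) \<and> deterministic C (\<tau> X) \<and> epic C (\<tau> X)) \<and>
     (\<forall>xs\<in>lists (qtypes QH). epic C (align_list C L H \<pi> \<tau> xs))"

definition surjective_alignment ::
  "('o, 'm) markov_cat \<Rightarrow> ('u, 'r, 'o, 'm) qmodel \<Rightarrow> ('t, 'q) qsig \<Rightarrow> ('t, 'q, 'o, 'm) qmodel
    \<Rightarrow> ('t \<Rightarrow> 'u list) \<Rightarrow> ('t \<Rightarrow> 'm) \<Rightarrow> bool" where
  "surjective_alignment C L QH H \<pi> \<tau> \<longleftrightarrow>
     (\<forall>X\<in>qtypes QH. \<forall>t. sharp_state C (FObj H [X]) t \<longrightarrow>
        (\<exists>s. sharp_state C (FObj L (\<pi> X)) s \<and> t = Comp C (\<tau> X) s))"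

text \<open>
  A functor between the free categories acts on lists by concatenation, i.e. is strict monoidal.
  The map \<open>\<kappa>\<close> on queries is part of the data, since the functor alone need not determine it:
  all generators with the same inputs and no output are equal to discarding.
\<close>

definition downward_abstraction ::
  "('o, 'm) markov_cat \<Rightarrow> ('u, 'r) qsig \<Rightarrow> ('u, 'r, 'o, 'm) qmodel
    \<Rightarrow> ('t, 'q) qsig \<Rightarrow> ('t, 'q, 'o, 'm) qmodel
    \<Rightarrow> ('t, 'q, 'u list, ('u, 'r) diag set) qmodel \<Rightarrow> ('q \<Rightarrow> 'r) \<Rightarrow> ('t list \<Rightarrow> 'm) \<Rightarrow> bool" where
  "downward_abstraction C QL L QH H \<pi> \<kappa> \<tau> \<longleftrightarrow>
     model C QL L \<and> model C QH H \<and>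
     markov_functor (free_markov QH) (free_markov QL) \<pi> \<and>
     (\<forall>xs\<in>lists (qtypes QH). \<forall>ys\<in>lists (qtypes QH).
        FObj \<pi> (xs @ ys) = FObj \<pi> xs @ FObj \<pi> ys \<and>
        FMult \<pi> xs ys = Ident (free_markov QL) (FObj \<pi> xs @ FObj \<pi> ys)) \<and>
     FObj \<pi> [] = [] \<and> FUnit \<pi> = Ident (free_markov QL) [] \<and>
     (\<forall>q\<in>queries QH. \<kappa> q \<in> queries QL \<and> FArr \<pi> (gen QH q) = gen QL (\<kappa> q)) \<and>
     epic_transformation (free_markov QH) C (functor_comp C L \<pi>) H \<tau>"

definition type_part :: "('t list \<Rightarrow> 'a) \<Rightarrow> 't \<Rightarrow> 'a" where
  "type_part f X = f [X]"

definition upward_abstraction ::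
  "('o, 'm) markov_cat \<Rightarrow> ('u, 'r) qsig \<Rightarrow> ('u, 'r, 'o, 'm) qmodel
    \<Rightarrow> ('t, 'q) qsig \<Rightarrow> ('t, 'q, 'o, 'm) qmodel
    \<Rightarrow> ('t \<Rightarrow> 'u list) \<Rightarrow> ('t \<Rightarrow> 'm) \<Rightarrow> ('r \<rightharpoonup> 'q) \<Rightarrow> bool" where
  "upward_abstraction C QL L QH H \<pi> \<tau> \<omega> \<longleftrightarrow>
     type_alignment C QL L QH H \<pi> \<tau> \<and>
     dom \<omega> \<subseteq> queries QL \<and> ran \<omega> = queries QH \<and>
     (\<forall>r q. \<omega> r = Some q \<longrightarrow>
        qin QL r = concat (map \<pi> (qin QH q)) \<and> qout QL r = concat (map \<pi> (qout QH q)) \<and>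
        Comp C (align_list C L H \<pi> \<tau> (qout QH q)) (FArr L (gen QL r)) =
        Comp C (FArr H (gen QH q)) (align_list C L H \<pi> \<tau> (qin QH q)))"

text \<open>
  The positions in \<open>concat (map \<pi> xs)\<close> of the blocks \<open>\<pi> (xs ! i)\<close> with \<open>i \<in> Z\<close>.
\<close>

definition block_positions :: "('t \<Rightarrow> 'u list) \<Rightarrow> 't list \<Rightarrow> nat set \<Rightarrow> nat set" where
  "block_positions \<pi> xs Z =
     (\<Union>i\<in>Z \<inter> {..<length xs}.
        {length (concat (map \<pi> (take i xs))) ..< length (concat (map \<pi> (take (Suc i) xs)))})"

definition sh_graph ::
  "('o, 'm) markov_cat \<Rightarrow> ('u, 'r, 'o, 'm) qmodel \<Rightarrow> ('t, 'q) qsig \<Rightarrow> ('q \<Rightarrow> nat set)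
    \<Rightarrow> ('t, 'q, 'u list, ('u, 'r) diag set) qmodel \<Rightarrow> ('q \<Rightarrow> 'r) \<Rightarrow> ('t list \<Rightarrow> 'm)
    \<Rightarrow> (('r \<times> 'm) \<times> ('q \<times> 'm)) set" where
  \<comment> \<open>all instances of the assignment \<open>(\<pi> q, s) \<mapsto> (q, \<tau> \<circ> s)\<close>; this relation need not be single-valued
      if \<open>\<kappa>\<close> identifies two queries\<close>
  "sh_graph C L QH ZH \<pi> \<kappa> \<tau> =
     {((\<kappa> q, s), (q, Comp C (\<tau> (nths (qin QH q) (ZH q))) s)) | q s.
        q \<in> queries QH \<and> sharp_state C (FObj L (FObj \<pi> (nths (qin QH q) (ZH q)))) s}"

end

theory Submission
  imports Defs
begin

text \<open>
  Two points carry the proof. First, plugging a state into some inputs is natural in the alignment: the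
  permutation of wires that isolates the inputs \<open>Z\<close> is a string diagram, a strict functor sends it to the
  permutation that isolates the corresponding blocks, and so naturality and monoidality of \<open>\<tau>\<close> give
  \<open>\<tau> \<circ> plug (\<kappa> q, s) = plug (q, \<tau> \<circ> s) \<circ> \<tau>\<close>. Second, \<open>\<omega>\<close> is surjective because surjectivity of \<open>\<tau>\<close> passes
  from types to lists of types: a sharp state of a tensor product is the product of its marginals.
\<close>

section \<open>Arrows of a Markov category\<close>

text \<open>The category \<open>C\<close> is not strict, whereas the free categories are, and much
  of the work lies in this gap. The marginals of a state pass through unitors, whose determinism is
  not an axiom: it follows from \<open>copy_tens\<close>, but only once the compatibility of unitors
  with associators and swaps has been derived from pentagon, triangle and hexagon. Values of
  diagrams over a plugged signature respect the strict axioms of \<open>deq\<close> because the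
  structure isomorphisms of the given model absorb the associators and unitors. A second obstacle is
  granularity: the permutation over \<open>QH\<close> moves one wire per type, its counterpart over
  \<open>QL\<close> moves the wires of a block \<open>\<pi> X\<close> one by one, so moving a block
  at once has to be compared with moving its wires in turn, up to \<open>deq\<close>. Finally,
  \<omega> is obtained as the partial map whose graph is \<open>sh_graph\<close>, which is why the
  theorem assumes this relation to be single-valued.\<close>

lemma HomI: "\<lbrakk>f \<in> Arr C; Dom C f = X; Cod C f = Y\<rbrakk> \<Longrightarrow> f \<in> Hom C X Y"
  by (simp add: Hom_def)

lemma HomD: "f \<in> Hom C X Y \<Longrightarrow> f \<in> Arr C \<and> Dom C f = X \<and> Cod C f = Y"
  by (simp add: Hom_def)

context category
begin

lemmas [simp] = dom_obj cod_obj

lemma ident_simps [simp]: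
  assumes "X \<in> Obj C"
  shows "Ident C X \<in> Arr C" "Dom C (Ident C X) = X" "Cod C (Ident C X) = X"
  using HomD[OF id_hom[OF assms]] by auto

text \<open>Typing is phrased by \<open>Arr\<close>, \<open>Dom\<close> and \<open>Cod\<close>
  instead of \<open>Hom\<close>: a \<open>Hom\<close> premise would leave the intermediate object to
  be guessed, whereas these side conditions are evaluated by rewriting.\<close>

lemma comp_simps [simp]:
  assumes "f \<in> Arr C" "g \<in> Arr C" "Dom C g = Cod C f"
  shows "g \<cdot> f \<in> Arr C" "Dom C (g \<cdot> f) = Dom C f" "Cod C (g \<cdot> f) = Cod C g"
  using HomD[OF comp_hom[of f "Dom C f" "Cod C f" g "Cod C g"]] assms by (auto simp: Hom_def)

lemma comp_ident_left [simp]: "\<lbrakk>f \<in> Arr C; Cod C f = Y\<rbrakk> \<Longrightarrow> Ident C Y \<cdot> f = f"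
  by (rule id_left) (simp add: Hom_def)

lemma comp_ident_right [simp]: "\<lbrakk>f \<in> Arr C; Dom C f = X\<rbrakk> \<Longrightarrow> f \<cdot> Ident C X = f"
  by (rule id_right) (simp add: Hom_def)

lemma comp_assoc' [simp]:
  assumes "f \<in> Arr C" "g \<in> Arr C" "h \<in> Arr C" "Dom C g = Cod C f" "Dom C h = Cod C g"
  shows "h \<cdot> g \<cdot> f = h \<cdot> (g \<cdot> f)"
  using comp_assoc[of f "Dom C f" "Cod C f" g "Cod C g" h "Cod C h"] assms by (simp add: Hom_def)

lemma inverse_arrows_unique:
  assumes "inverse_arrows C f g" "inverse_arrows C f h"
  shows "g = h"
proof -
  have *: "f \<in> Arr C" "g \<in> Arr C" "h \<in> Arr C" "Dom C g = Cod C f" "Dom C h = Cod C f"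
    "Cod C g = Dom C f" "Cod C h = Dom C f" "g \<cdot> f = Ident C (Dom C f)" "f \<cdot> h = Ident C (Cod C f)"
    using assms by (auto simp: inverse_arrows_def Hom_def)
  have "g = g \<cdot> (f \<cdot> h)"
    using * by (simp del: comp_assoc')
  also have "\<dots> = g \<cdot> f \<cdot> h"
    by (rule comp_assoc'[symmetric]) (use * in simp_all)
  also have "\<dots> = h"
    using * by (simp del: comp_assoc')
  finally show ?thesis .
qed

lemma Inv_eqI: "inverse_arrows C f g \<Longrightarrow> Inv C f = g"
  unfolding Inv_def using inverse_arrows_unique by blast

lemma isoD: "iso C f \<Longrightarrow> inverse_arrows C f (Inv C f)"
  using Inv_eqI by (auto simp: iso_def)

lemma iso_simps [simp]:
  assumes "iso C f"
  shows "f \<in> Arr C" "Inv C f \<in> Arr C" "Dom C (Inv C f) = Cod C f" "Cod C (Inv C f) = Dom C f"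
    "Inv C f \<cdot> f = Ident C (Dom C f)" "f \<cdot> Inv C f = Ident C (Cod C f)"
  using isoD[OF assms] by (auto simp: inverse_arrows_def Hom_def)

text \<open>In composites nested to the right, an isomorphism meets its inverse in front of a
  remaining factor \<open>g\<close>, where the two-factor cancellation laws do not match.\<close>

lemma iso_cancel [simp]:
  assumes "iso C f" "g \<in> Arr C"
  shows "Dom C f = Cod C g \<Longrightarrow> Inv C f \<cdot> (f \<cdot> g) = g"
    and "Cod C f = Cod C g \<Longrightarrow> f \<cdot> (Inv C f \<cdot> g) = g"
proof -
  show "Inv C f \<cdot> (f \<cdot> g) = g" if "Dom C f = Cod C g"
    using comp_assoc'[of g f "Inv C f"] assms that by (simp del: comp_assoc')
  show "f \<cdot> (Inv C f \<cdot> g) = g" if "Cod C f = Cod C g"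
    using comp_assoc'[of g "Inv C f" f] assms that by (simp del: comp_assoc')
qed

lemma iso_mono:
  assumes "iso C f" "g \<in> Arr C" "h \<in> Arr C" "Cod C g = Dom C f" "Cod C h = Dom C f" "f \<cdot> g = f \<cdot> h"
  shows "g = h"
  using assms by (metis iso_cancel(1))

lemma iso_epi:
  assumes "iso C f" "g \<in> Arr C" "h \<in> Arr C" "Dom C g = Cod C f" "Dom C h = Cod C f" "g \<cdot> f = h \<cdot> f"
  shows "g = h"
proof -
  have "g \<cdot> f \<cdot> Inv C f = h \<cdot> f \<cdot> Inv C f"
    using assms by simp
  with assms(1-5) show ?thesis by simp
qed

text \<open>Compose the square with \<open>Inv C a\<close> on one side and \<open>Inv C b\<close> on
  the other. This transfers naturality of a structure isomorphism to its inverse.\<close>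

lemma inv_square:
  assumes "iso C a" "iso C b" "p \<in> Hom C (Dom C b) (Dom C a)" "q \<in> Hom C (Cod C b) (Cod C a)"
    and "a \<cdot> p = q \<cdot> b"
  shows "Inv C a \<cdot> q = p \<cdot> Inv C b"
proof -
  note assms(3,4)[THEN HomD, simp]
  have "q = q \<cdot> b \<cdot> Inv C b"
    using assms(1,2) by simp
  also have "\<dots> = a \<cdot> p \<cdot> Inv C b"
    using assms(5) by simp
  finally have "Inv C a \<cdot> q = Inv C a \<cdot> (a \<cdot> p \<cdot> Inv C b)"
    by simp
  with assms(1,2) show ?thesis by simp
qed

end

section \<open>Tensor calculus and the exchange of middle factors\<close>

context symmetric_monoidal_category
begin

lemmas [simp] = unit_obj tens_obj

lemma tens_simps [simp]:
  assumes "f \<in> Arr C" "g \<in> Arr C"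
  shows "f \<otimes> g \<in> Arr C" "Dom C (f \<otimes> g) = Dom C f \<odot> Dom C g" "Cod C (f \<otimes> g) = Cod C f \<odot> Cod C g"
  using HomD[OF tens_hom[of f "Dom C f" "Cod C f" g "Dom C g" "Cod C g"]] assms
  by (auto simp: Hom_def)

lemmas [simp] = tens_id assoc_iso lunit_iso runit_iso

lemma structure_simps [simp]:
  assumes "X \<in> Obj C"
  shows "LUnit C X \<in> Arr C" "Dom C (LUnit C X) = UnitO C \<odot> X" "Cod C (LUnit C X) = X"
    "RUnit C X \<in> Arr C" "Dom C (RUnit C X) = X \<odot> UnitO C" "Cod C (RUnit C X) = X"
    "Y \<in> Obj C \<Longrightarrow> Swap C X Y \<in> Arr C" "Y \<in> Obj C \<Longrightarrow> Dom C (Swap C X Y) = X \<odot> Y"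
    "Y \<in> Obj C \<Longrightarrow> Cod C (Swap C X Y) = Y \<odot> X"
    "\<lbrakk>Y \<in> Obj C; Z \<in> Obj C\<rbrakk> \<Longrightarrow> Assoc C X Y Z \<in> Arr C"
    "\<lbrakk>Y \<in> Obj C; Z \<in> Obj C\<rbrakk> \<Longrightarrow> Dom C (Assoc C X Y Z) = (X \<odot> Y) \<odot> Z"
    "\<lbrakk>Y \<in> Obj C; Z \<in> Obj C\<rbrakk> \<Longrightarrow> Cod C (Assoc C X Y Z) = X \<odot> (Y \<odot> Z)"
  using assms lunit_hom runit_hom swap_hom assoc_hom by (auto simp: Hom_def)

lemma tens_comp [simp]:
  assumes "f \<in> Arr C" "g \<in> Arr C" "f' \<in> Arr C" "g' \<in> Arr C" "Dom C g = Cod C f" "Dom C g' = Cod C f'"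
  shows "(g \<otimes> g') \<cdot> (f \<otimes> f') = (g \<cdot> f) \<otimes> (g' \<cdot> f')"
  using interchange[of f "Dom C f" "Cod C f" g "Cod C g" f' "Dom C f'" "Cod C f'" g' "Cod C g'"] assms
  by (simp add: Hom_def)

lemma tens_comp_assoc [simp]:
  assumes "f \<in> Arr C" "g \<in> Arr C" "f' \<in> Arr C" "g' \<in> Arr C" "Dom C g = Cod C f" "Dom C g' = Cod C f'"
    "k \<in> Arr C" "Cod C k = Dom C f \<odot> Dom C f'"
  shows "(g \<otimes> g') \<cdot> ((f \<otimes> f') \<cdot> k) = ((g \<cdot> f) \<otimes> (g' \<cdot> f')) \<cdot> k"
  using comp_assoc'[of k "f \<otimes> f'" "g \<otimes> g'"] assms by (simp del: comp_assoc')

lemma iso_tens: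
  assumes "iso C f" "iso C g"
  shows "iso C (f \<otimes> g)" "Inv C (f \<otimes> g) = Inv C f \<otimes> Inv C g"
proof -
  have "inverse_arrows C (f \<otimes> g) (Inv C f \<otimes> Inv C g)"
    using assms by (simp add: inverse_arrows_def Hom_def)
  then show "iso C (f \<otimes> g)" "Inv C (f \<otimes> g) = Inv C f \<otimes> Inv C g"
    using Inv_eqI by (auto simp: iso_def)
qed

lemma assoc_natural':
  assumes "f \<in> Arr C" "g \<in> Arr C" "h \<in> Arr C"
  shows "Assoc C (Cod C f) (Cod C g) (Cod C h) \<cdot> ((f \<otimes> g) \<otimes> h) =
    (f \<otimes> (g \<otimes> h)) \<cdot> Assoc C (Dom C f) (Dom C g) (Dom C h)"
  using assms by (intro assoc_natural) (auto simp: Hom_def)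

lemma inv_assoc_natural:
  assumes "f \<in> Arr C" "g \<in> Arr C" "h \<in> Arr C"
  shows "Inv C (Assoc C (Cod C f) (Cod C g) (Cod C h)) \<cdot> (f \<otimes> (g \<otimes> h)) =
    ((f \<otimes> g) \<otimes> h) \<cdot> Inv C (Assoc C (Dom C f) (Dom C g) (Dom C h))"
  by (rule inv_square) (use assms assoc_natural' in \<open>auto simp: Hom_def\<close>)

text \<open>\<open>middle_swap\<close> with four independent objects. Naturality has to be applied
  to four different arrows, for instance identities next to discards, so the repeated objects of
  \<open>middle_swap\<close> are too special.\<close>

definition four_swap :: "'a \<Rightarrow> 'a \<Rightarrow> 'a \<Rightarrow> 'a \<Rightarrow> 'b" where
  "four_swap W X Y Z = Inv C (Assoc C W Y (X \<odot> Z)) \<cdot>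
     ((Ident C W \<otimes> (Assoc C Y X Z \<cdot> ((Swap C X Y \<otimes> Ident C Z) \<cdot> Inv C (Assoc C X Y Z)))) \<cdot>
      Assoc C W X (Y \<odot> Z))"

lemma middle_swap_eq: "middle_swap C X Y = four_swap X X Y Y"
  by (simp add: middle_swap_def four_swap_def)

lemma four_swap_simps [simp]:
  assumes "W \<in> Obj C" "X \<in> Obj C" "Y \<in> Obj C" "Z \<in> Obj C"
  shows "four_swap W X Y Z \<in> Arr C" "Dom C (four_swap W X Y Z) = (W \<odot> X) \<odot> (Y \<odot> Z)"
    "Cod C (four_swap W X Y Z) = (W \<odot> Y) \<odot> (X \<odot> Z)"
  using assms by (simp_all add: four_swap_def)

lemma four_swap_natural:
  assumes [simp]: "f \<in> Arr C" "g \<in> Arr C" "h \<in> Arr C" "k \<in> Arr C"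
  shows "four_swap (Cod C f) (Cod C g) (Cod C h) (Cod C k) \<cdot> ((f \<otimes> g) \<otimes> (h \<otimes> k)) =
    ((f \<otimes> h) \<otimes> (g \<otimes> k)) \<cdot> four_swap (Dom C f) (Dom C g) (Dom C h) (Dom C k)"
proof -
  \<comment> \<open>\<open>m\<close> is the block of \<open>four_swap\<close> that acts on the last
    three factors. Its naturality is settled on its own, so that only the two outer associators
    remain.\<close>
  define m where "m X Y Z = Assoc C Y X Z \<cdot> ((Swap C X Y \<otimes> Ident C Z) \<cdot> Inv C (Assoc C X Y Z))" for X Y Z
  have m_simps [simp]: "m X Y Z \<in> Arr C" "Dom C (m X Y Z) = X \<odot> (Y \<odot> Z)" "Cod C (m X Y Z) = Y \<odot> (X \<odot> Z)"
    if "X \<in> Obj C" "Y \<in> Obj C" "Z \<in> Obj C" for X Y Z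
    using that by (simp_all add: m_def)
  have sw: "Swap C (Cod C g) (Cod C h) \<cdot> (g \<otimes> h) = (h \<otimes> g) \<cdot> Swap C (Dom C g) (Dom C h)"
    by (rule swap_natural) (auto simp: Hom_def)
  have m: "m (Cod C g) (Cod C h) (Cod C k) \<cdot> (g \<otimes> (h \<otimes> k)) =
      (h \<otimes> (g \<otimes> k)) \<cdot> m (Dom C g) (Dom C h) (Dom C k)"
  proof -
    have "m (Cod C g) (Cod C h) (Cod C k) \<cdot> (g \<otimes> (h \<otimes> k)) =
      Assoc C (Cod C h) (Cod C g) (Cod C k) \<cdot> ((Swap C (Cod C g) (Cod C h) \<otimes> Ident C (Cod C k)) \<cdot>
        (Inv C (Assoc C (Cod C g) (Cod C h) (Cod C k)) \<cdot> (g \<otimes> (h \<otimes> k))))"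
      by (simp add: m_def)
    also have "\<dots> = Assoc C (Cod C h) (Cod C g) (Cod C k) \<cdot> (((h \<otimes> g) \<otimes> k) \<cdot>
        ((Swap C (Dom C g) (Dom C h) \<otimes> Ident C (Dom C k)) \<cdot> Inv C (Assoc C (Dom C g) (Dom C h) (Dom C k))))"
      by (simp add: inv_assoc_natural sw)
    also have "\<dots> = Assoc C (Cod C h) (Cod C g) (Cod C k) \<cdot> ((h \<otimes> g) \<otimes> k) \<cdot>
        ((Swap C (Dom C g) (Dom C h) \<otimes> Ident C (Dom C k)) \<cdot> Inv C (Assoc C (Dom C g) (Dom C h) (Dom C k)))"
      by simp
    also have "\<dots> = (h \<otimes> (g \<otimes> k)) \<cdot> m (Dom C g) (Dom C h) (Dom C k)"
      unfolding assoc_natural'[OF assms(3,2,4)] by (simp add: m_def)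
    finally show ?thesis .
  qed
  have fs: "four_swap W X Y Z = Inv C (Assoc C W Y (X \<odot> Z)) \<cdot> ((Ident C W \<otimes> m X Y Z) \<cdot> Assoc C W X (Y \<odot> Z))"
    for W X Y Z
    by (simp add: four_swap_def m_def)
  have "four_swap (Cod C f) (Cod C g) (Cod C h) (Cod C k) \<cdot> ((f \<otimes> g) \<otimes> (h \<otimes> k)) =
      Inv C (Assoc C (Cod C f) (Cod C h) (Cod C g \<odot> Cod C k)) \<cdot> ((Ident C (Cod C f) \<otimes> m (Cod C g) (Cod C h) (Cod C k)) \<cdot>
        (Assoc C (Cod C f) (Cod C g) (Cod C h \<odot> Cod C k) \<cdot> ((f \<otimes> g) \<otimes> (h \<otimes> k))))"
    by (simp add: fs)
  also have "Assoc C (Cod C f) (Cod C g) (Cod C h \<odot> Cod C k) \<cdot> ((f \<otimes> g) \<otimes> (h \<otimes> k)) =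
      (f \<otimes> (g \<otimes> (h \<otimes> k))) \<cdot> Assoc C (Dom C f) (Dom C g) (Dom C h \<odot> Dom C k)"
    using assoc_natural'[of f g "h \<otimes> k"] by simp
  also have "Inv C (Assoc C (Cod C f) (Cod C h) (Cod C g \<odot> Cod C k)) \<cdot>
      ((Ident C (Cod C f) \<otimes> m (Cod C g) (Cod C h) (Cod C k)) \<cdot>
        ((f \<otimes> (g \<otimes> (h \<otimes> k))) \<cdot> Assoc C (Dom C f) (Dom C g) (Dom C h \<odot> Dom C k))) =
      Inv C (Assoc C (Cod C f) (Cod C h) (Cod C g \<odot> Cod C k)) \<cdot> (f \<otimes> (h \<otimes> (g \<otimes> k))) \<cdot>
      ((Ident C (Dom C f) \<otimes> m (Dom C g) (Dom C h) (Dom C k)) \<cdot> Assoc C (Dom C f) (Dom C g) (Dom C h \<odot> Dom C k))"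
    by (simp add: m)
  also have "Inv C (Assoc C (Cod C f) (Cod C h) (Cod C g \<odot> Cod C k)) \<cdot> (f \<otimes> (h \<otimes> (g \<otimes> k))) =
      ((f \<otimes> h) \<otimes> (g \<otimes> k)) \<cdot> Inv C (Assoc C (Dom C f) (Dom C h) (Dom C g \<odot> Dom C k))"
    using inv_assoc_natural[of f h "g \<otimes> k"] by simp
  finally show ?thesis
    by (simp add: fs)
qed

lemma inv_runit_natural:
  "f \<in> Arr C \<Longrightarrow> Inv C (RUnit C (Cod C f)) \<cdot> f = (f \<otimes> Ident C (UnitO C)) \<cdot> Inv C (RUnit C (Dom C f))"
  by (rule inv_square) (auto simp: Hom_def intro!: runit_natural)

text \<open>The right unitor is a natural isomorphism from tensoring with the unit to the identity
  functor. Coherence equations may therefore be checked after tensoring with the unit, where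
  pentagon and triangle become applicable.\<close>

lemma tens_unit_right_faithful:
  assumes [simp]: "f \<in> Arr C" "g \<in> Arr C" "Dom C f = Dom C g" "Cod C f = Cod C g"
    and eq: "f \<otimes> Ident C (UnitO C) = g \<otimes> Ident C (UnitO C)"
  shows "f = g"
proof -
  have "f \<cdot> RUnit C (Dom C f) = g \<cdot> RUnit C (Dom C f)"
    using runit_natural[of f "Dom C f" "Cod C f"] runit_natural[of g "Dom C f" "Cod C f"] eq
    by (simp add: Hom_def)
  then show ?thesis
    by (rule iso_epi[rotated 5]) auto
qed

lemma tens_unit_left_faithful:
  assumes [simp]: "f \<in> Arr C" "g \<in> Arr C" "Dom C f = Dom C g" "Cod C f = Cod C g"
    and eq: "Ident C (UnitO C) \<otimes> f = Ident C (UnitO C) \<otimes> g"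
  shows "f = g"
proof -
  have "f \<cdot> LUnit C (Dom C f) = g \<cdot> LUnit C (Dom C f)"
    using lunit_natural[of f "Dom C f" "Cod C f"] lunit_natural[of g "Dom C f" "Cod C f"] eq
    by (simp add: Hom_def)
  then show ?thesis
    by (rule iso_epi[rotated 5]) auto
qed

lemma iso_ident [simp]: "X \<in> Obj C \<Longrightarrow> iso C (Ident C X)"
  unfolding iso_def inverse_arrows_def by (rule exI[of _ "Ident C X"]) (simp add: Hom_def)

lemma iso_comp:
  assumes "iso C f" "iso C g" "Dom C g = Cod C f"
  shows "iso C (g \<cdot> f)"
  unfolding iso_def inverse_arrows_def
  by (rule exI[of _ "Inv C f \<cdot> Inv C g"]) (use assms in \<open>simp add: Hom_def\<close>)

section \<open>Unit coherence derived from pentagon, triangle and hexagon\<close>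

lemma triangle':
  assumes [simp]: "X \<in> Obj C" "Y \<in> Obj C"
  shows "(RUnit C X \<otimes> Ident C Y) \<cdot> Inv C (Assoc C X (UnitO C) Y) = Ident C X \<otimes> LUnit C Y"
  by (simp add: triangle[symmetric])

text \<open>Kelly's argument: tensor with the unit on the left and precompose with the isomorphism
  \<open>?k\<close>, which completes one side of the pentagon for \<open>I, I, X, Y\<close>. The
  triangle and naturality of the associator do the rest.\<close>

lemma lunit_tens:
  assumes [simp]: "X \<in> Obj C" "Y \<in> Obj C"
  shows "LUnit C (X \<odot> Y) \<cdot> Assoc C (UnitO C) X Y = LUnit C X \<otimes> Ident C Y"
proof (rule tens_unit_left_faithful)
  let ?I = "UnitO C"
  let ?k = "Assoc C ?I (?I \<odot> X) Y \<cdot> (Assoc C ?I ?I X \<otimes> Ident C Y)"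
  have "(Ident C ?I \<otimes> (LUnit C (X \<odot> Y) \<cdot> Assoc C ?I X Y)) \<cdot> ?k =
      (Ident C ?I \<otimes> LUnit C (X \<odot> Y)) \<cdot> ((Ident C ?I \<otimes> Assoc C ?I X Y) \<cdot> Assoc C ?I (?I \<odot> X) Y \<cdot> (Assoc C ?I ?I X \<otimes> Ident C Y))"
    by simp
  also have "\<dots> = (Ident C ?I \<otimes> LUnit C (X \<odot> Y)) \<cdot> Assoc C ?I ?I (X \<odot> Y) \<cdot> Assoc C (?I \<odot> ?I) X Y"
    by (simp only: pentagon[symmetric] assms unit_obj) simp
  also have "\<dots> = (RUnit C ?I \<otimes> Ident C (X \<odot> Y)) \<cdot> Assoc C (?I \<odot> ?I) X Y"
    by (simp only: triangle assms unit_obj tens_obj)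
  also have "\<dots> = Assoc C ?I X Y \<cdot> ((RUnit C ?I \<otimes> Ident C X) \<otimes> Ident C Y)"
    using assoc_natural'[of "RUnit C ?I" "Ident C X" "Ident C Y"] by simp
  also have "\<dots> = Assoc C ?I X Y \<cdot> (((Ident C ?I \<otimes> LUnit C X) \<cdot> Assoc C ?I ?I X) \<otimes> Ident C Y)"
    by (simp only: triangle assms unit_obj tens_obj)
  also have "\<dots> = Assoc C ?I X Y \<cdot> ((Ident C ?I \<otimes> LUnit C X) \<otimes> Ident C Y) \<cdot> (Assoc C ?I ?I X \<otimes> Ident C Y)"
    by simp
  also have "Assoc C ?I X Y \<cdot> ((Ident C ?I \<otimes> LUnit C X) \<otimes> Ident C Y) =
      (Ident C ?I \<otimes> (LUnit C X \<otimes> Ident C Y)) \<cdot> Assoc C ?I (?I \<odot> X) Y"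
    using assoc_natural'[of "Ident C ?I" "LUnit C X" "Ident C Y"] by simp
  finally have "(Ident C ?I \<otimes> (LUnit C (X \<odot> Y) \<cdot> Assoc C ?I X Y)) \<cdot> ?k =
      (Ident C ?I \<otimes> (LUnit C X \<otimes> Ident C Y)) \<cdot> ?k"
    by simp
  then show "Ident C ?I \<otimes> (LUnit C (X \<odot> Y) \<cdot> Assoc C ?I X Y) = Ident C ?I \<otimes> (LUnit C X \<otimes> Ident C Y)"
    by (rule iso_epi[rotated 5]) (auto intro!: iso_comp iso_tens)
qed auto

text \<open>Mirror image of \<open>lunit_tens\<close>: tensor with the unit on the right,
  postcompose with the associator of \<open>X, Y, I\<close>, and use the pentagon for
  \<open>X, Y, I, I\<close>.\<close>

lemma runit_tens:
  assumes [simp]: "X \<in> Obj C" "Y \<in> Obj C"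
  shows "(Ident C X \<otimes> RUnit C Y) \<cdot> Assoc C X Y (UnitO C) = RUnit C (X \<odot> Y)"
proof (rule tens_unit_right_faithful)
  let ?I = "UnitO C"
  have "Assoc C X Y ?I \<cdot> (((Ident C X \<otimes> RUnit C Y) \<cdot> Assoc C X Y ?I) \<otimes> Ident C ?I) =
      Assoc C X Y ?I \<cdot> ((Ident C X \<otimes> RUnit C Y) \<otimes> Ident C ?I) \<cdot> (Assoc C X Y ?I \<otimes> Ident C ?I)"
    by simp
  also have "Assoc C X Y ?I \<cdot> ((Ident C X \<otimes> RUnit C Y) \<otimes> Ident C ?I) =
      (Ident C X \<otimes> (RUnit C Y \<otimes> Ident C ?I)) \<cdot> Assoc C X (Y \<odot> ?I) ?I"
    using assoc_natural'[of "Ident C X" "RUnit C Y" "Ident C ?I"] by simp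
  also have "\<dots> = (Ident C X \<otimes> ((Ident C Y \<otimes> LUnit C ?I) \<cdot> Assoc C Y ?I ?I)) \<cdot> Assoc C X (Y \<odot> ?I) ?I"
    by (simp only: triangle assms unit_obj tens_obj)
  also have "\<dots> \<cdot> (Assoc C X Y ?I \<otimes> Ident C ?I) = (Ident C X \<otimes> (Ident C Y \<otimes> LUnit C ?I)) \<cdot>
      ((Ident C X \<otimes> Assoc C Y ?I ?I) \<cdot> Assoc C X (Y \<odot> ?I) ?I \<cdot> (Assoc C X Y ?I \<otimes> Ident C ?I))"
    by simp
  also have "\<dots> = (Ident C X \<otimes> (Ident C Y \<otimes> LUnit C ?I)) \<cdot> Assoc C X Y (?I \<odot> ?I) \<cdot> Assoc C (X \<odot> Y) ?I ?I"
    by (simp only: pentagon[symmetric] assms unit_obj) simp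
  also have "(Ident C X \<otimes> (Ident C Y \<otimes> LUnit C ?I)) \<cdot> Assoc C X Y (?I \<odot> ?I) =
      Assoc C X Y ?I \<cdot> (Ident C (X \<odot> Y) \<otimes> LUnit C ?I)"
    using assoc_natural'[of "Ident C X" "Ident C Y" "LUnit C ?I"] by simp
  also have "\<dots> \<cdot> Assoc C (X \<odot> Y) ?I ?I = Assoc C X Y ?I \<cdot> (RUnit C (X \<odot> Y) \<otimes> Ident C ?I)"
    using triangle[of "X \<odot> Y" ?I] by simp
  finally show "((Ident C X \<otimes> RUnit C Y) \<cdot> Assoc C X Y ?I) \<otimes> Ident C ?I = RUnit C (X \<odot> Y) \<otimes> Ident C ?I"
    by (rule iso_mono[rotated 5]) auto
qed auto

text \<open>Compatibility of the swap with units is a consequence of the hexagon for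
  \<open>X, I, I\<close>. The comparison is made after tensoring with the unit and postcomposing
  with \<open>Swap C X I\<close>, which is invertible.\<close>

lemma lunit_swap:
  assumes [simp]: "X \<in> Obj C"
  shows "LUnit C X \<cdot> Swap C X (UnitO C) = RUnit C X"
proof (rule tens_unit_right_faithful)
  let ?I = "UnitO C"
  have iso: "iso C (Swap C X ?I)"
    unfolding iso_def inverse_arrows_def by (rule exI[of _ "Swap C ?I X"]) (simp add: Hom_def swap_swap)
  have "Swap C X ?I \<cdot> (RUnit C X \<otimes> Ident C ?I) = Swap C X ?I \<cdot> (Ident C X \<otimes> LUnit C ?I) \<cdot> Assoc C X ?I ?I"
    using triangle[of X ?I] by simp
  also have "\<dots> = (LUnit C ?I \<otimes> Ident C X) \<cdot> Swap C X (?I \<odot> ?I) \<cdot> Assoc C X ?I ?I"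
    using swap_natural[of "Ident C X" X X "LUnit C ?I" "?I \<odot> ?I" ?I] by (simp add: Hom_def)
  also have "\<dots> = LUnit C (?I \<odot> X) \<cdot> (Assoc C ?I ?I X \<cdot> Swap C X (?I \<odot> ?I) \<cdot> Assoc C X ?I ?I)"
    by (simp add: lunit_tens[symmetric])
  also have "\<dots> = LUnit C (?I \<odot> X) \<cdot> (Ident C ?I \<otimes> Swap C X ?I) \<cdot> (Assoc C ?I X ?I \<cdot> (Swap C X ?I \<otimes> Ident C ?I))"
    by (simp only: hexagon assms unit_obj) simp
  also have "LUnit C (?I \<odot> X) \<cdot> (Ident C ?I \<otimes> Swap C X ?I) = Swap C X ?I \<cdot> LUnit C (X \<odot> ?I)"
    by (rule lunit_natural) (simp add: Hom_def)
  also have "\<dots> \<cdot> (Assoc C ?I X ?I \<cdot> (Swap C X ?I \<otimes> Ident C ?I)) =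
      Swap C X ?I \<cdot> (LUnit C (X \<odot> ?I) \<cdot> Assoc C ?I X ?I \<cdot> (Swap C X ?I \<otimes> Ident C ?I))"
    by simp
  also have "\<dots> = Swap C X ?I \<cdot> ((LUnit C X \<cdot> Swap C X ?I) \<otimes> Ident C ?I)"
    by (simp only: lunit_tens assms unit_obj) simp
  finally show "(LUnit C X \<cdot> Swap C X ?I) \<otimes> Ident C ?I = RUnit C X \<otimes> Ident C ?I"
    by (rule iso_mono[OF iso, rotated 4, symmetric]) auto
qed auto

lemma runit_swap:
  assumes [simp]: "X \<in> Obj C"
  shows "RUnit C X \<cdot> Swap C (UnitO C) X = LUnit C X"
proof -
  have "RUnit C X \<cdot> Swap C (UnitO C) X = LUnit C X \<cdot> (Swap C X (UnitO C) \<cdot> Swap C (UnitO C) X)"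
    by (simp add: lunit_swap[symmetric])
  then show ?thesis
    by (simp add: swap_swap)
qed

text \<open>\<open>copy_tens\<close> expresses copying on \<open>X \<odot> I\<close> through a
  \<open>four_swap\<close>, and this equation removes it; determinism of the right unitor rests on
  it. Triangle, \<open>lunit_tens\<close> and \<open>lunit_swap\<close> erase the unit that crosses
  \<open>Y\<close>.\<close>

lemma four_swap_runit:
  assumes [simp]: "X \<in> Obj C" "Y \<in> Obj C"
  shows "(RUnit C X \<otimes> RUnit C Y) \<cdot> four_swap X Y (UnitO C) (UnitO C) =
    RUnit C (X \<odot> Y) \<cdot> (Ident C (X \<odot> Y) \<otimes> LUnit C (UnitO C))"
proof -
  let ?I = "UnitO C"
  have "(RUnit C X \<otimes> RUnit C Y) \<cdot> four_swap X Y ?I ?I = (Ident C X \<otimes> RUnit C Y) \<cdot>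
      ((RUnit C X \<otimes> Ident C (Y \<odot> ?I)) \<cdot> Inv C (Assoc C X ?I (Y \<odot> ?I)) \<cdot>
      (Ident C X \<otimes> (Assoc C ?I Y ?I \<cdot> ((Swap C Y ?I \<otimes> Ident C ?I) \<cdot> Inv C (Assoc C Y ?I ?I))))) \<cdot> Assoc C X Y (?I \<odot> ?I)"
    by (simp add: four_swap_def)
  also have "\<dots> = (Ident C X \<otimes> (RUnit C Y \<cdot> (LUnit C (Y \<odot> ?I) \<cdot> Assoc C ?I Y ?I \<cdot>
      ((Swap C Y ?I \<otimes> Ident C ?I) \<cdot> Inv C (Assoc C Y ?I ?I))))) \<cdot> Assoc C X Y (?I \<odot> ?I)"
    by (simp only: triangle' assms unit_obj tens_obj) simp
  also have "LUnit C (Y \<odot> ?I) \<cdot> Assoc C ?I Y ?I \<cdot> ((Swap C Y ?I \<otimes> Ident C ?I) \<cdot> Inv C (Assoc C Y ?I ?I)) =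
      Ident C Y \<otimes> LUnit C ?I"
    by (simp only: lunit_tens assms unit_obj) (simp add: lunit_swap triangle')
  also have "(Ident C X \<otimes> (RUnit C Y \<cdot> (Ident C Y \<otimes> LUnit C ?I))) \<cdot> Assoc C X Y (?I \<odot> ?I) =
      (Ident C X \<otimes> RUnit C Y) \<cdot> ((Ident C X \<otimes> (Ident C Y \<otimes> LUnit C ?I)) \<cdot> Assoc C X Y (?I \<odot> ?I))"
    by simp
  also have "(Ident C X \<otimes> (Ident C Y \<otimes> LUnit C ?I)) \<cdot> Assoc C X Y (?I \<odot> ?I) =
      Assoc C X Y ?I \<cdot> (Ident C (X \<odot> Y) \<otimes> LUnit C ?I)"
    using assoc_natural'[of "Ident C X" "Ident C Y" "LUnit C ?I"] by simp
  also have "(Ident C X \<otimes> RUnit C Y) \<cdot> \<dots> = (Ident C X \<otimes> RUnit C Y) \<cdot> Assoc C X Y ?I \<cdot> (Ident C (X \<odot> Y) \<otimes> LUnit C ?I)"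
    by simp
  finally show ?thesis
    by (simp only: runit_tens assms)
qed

lemma four_swap_lunit:
  assumes [simp]: "X \<in> Obj C" "Y \<in> Obj C"
  shows "(LUnit C X \<otimes> LUnit C Y) \<cdot> four_swap (UnitO C) (UnitO C) X Y =
    LUnit C (X \<odot> Y) \<cdot> (LUnit C (UnitO C) \<otimes> Ident C (X \<odot> Y))"
proof -
  let ?I = "UnitO C"
  have l: "(LUnit C X \<otimes> Ident C Z) \<cdot> Inv C (Assoc C ?I X Z) = LUnit C (X \<odot> Z)" if "Z \<in> Obj C" for Z
    using that by (simp add: lunit_tens[symmetric])
  have "(LUnit C X \<otimes> LUnit C Y) \<cdot> four_swap ?I ?I X Y = (Ident C X \<otimes> LUnit C Y) \<cdot>
      ((LUnit C X \<otimes> Ident C (?I \<odot> Y)) \<cdot> Inv C (Assoc C ?I X (?I \<odot> Y)) \<cdot>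
      (Ident C ?I \<otimes> (Assoc C X ?I Y \<cdot> ((Swap C ?I X \<otimes> Ident C Y) \<cdot> Inv C (Assoc C ?I X Y))))) \<cdot> Assoc C ?I ?I (X \<odot> Y)"
    by (simp add: four_swap_def)
  also have "\<dots> = (Ident C X \<otimes> LUnit C Y) \<cdot> (LUnit C (X \<odot> (?I \<odot> Y)) \<cdot>
      (Ident C ?I \<otimes> (Assoc C X ?I Y \<cdot> ((Swap C ?I X \<otimes> Ident C Y) \<cdot> Inv C (Assoc C ?I X Y))))) \<cdot> Assoc C ?I ?I (X \<odot> Y)"
    by (simp only: l assms unit_obj tens_obj)
  also have "LUnit C (X \<odot> (?I \<odot> Y)) \<cdot>
      (Ident C ?I \<otimes> (Assoc C X ?I Y \<cdot> ((Swap C ?I X \<otimes> Ident C Y) \<cdot> Inv C (Assoc C ?I X Y)))) =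
      (Assoc C X ?I Y \<cdot> ((Swap C ?I X \<otimes> Ident C Y) \<cdot> Inv C (Assoc C ?I X Y))) \<cdot> LUnit C (?I \<odot> (X \<odot> Y))"
    by (rule lunit_natural) (simp add: Hom_def)
  also have "(Ident C X \<otimes> LUnit C Y) \<cdot> \<dots> \<cdot> Assoc C ?I ?I (X \<odot> Y) =
      ((Ident C X \<otimes> LUnit C Y) \<cdot> Assoc C X ?I Y) \<cdot> ((Swap C ?I X \<otimes> Ident C Y) \<cdot> Inv C (Assoc C ?I X Y)) \<cdot>
      (LUnit C (?I \<odot> (X \<odot> Y)) \<cdot> Assoc C ?I ?I (X \<odot> Y))"
    by simp
  also have "((Ident C X \<otimes> LUnit C Y) \<cdot> Assoc C X ?I Y) \<cdot> ((Swap C ?I X \<otimes> Ident C Y) \<cdot> Inv C (Assoc C ?I X Y)) =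
      LUnit C (X \<odot> Y)"
    by (simp only: triangle assms) (simp add: runit_swap l)
  finally show ?thesis
    by (simp only: lunit_tens assms unit_obj tens_obj)
qed

end

section \<open>Deterministic arrows and sharp states\<close>

context markov_category
begin

lemma copy_discard_simps [simp]:
  assumes "X \<in> Obj C"
  shows "Copy C X \<in> Arr C" "Dom C (Copy C X) = X" "Cod C (Copy C X) = X \<odot> X"
    "Discard C X \<in> Arr C" "Dom C (Discard C X) = X" "Cod C (Discard C X) = UnitO C"
  using assms copy_hom discard_hom by (auto simp: Hom_def)

text \<open>Carries the uniqueness in \<open>discard_unique\<close> from the unit over to objects
  isomorphic to it, such as \<open>I \<odot> I\<close> and the value of the empty list in a
  model.\<close>

definition terminal :: "'a \<Rightarrow> bool" where
  "terminal T \<longleftrightarrow> T \<in> Obj C \<and> (\<forall>X f g. f \<in> Hom C X T \<longrightarrow> g \<in> Hom C X T \<longrightarrow> f = g)"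

lemma terminal_unit: "terminal (UnitO C)"
  using discard_unique by (auto simp: terminal_def)

lemma terminal_iso:
  assumes "iso C f" "terminal (Dom C f) \<or> terminal (Cod C f)"
  shows "terminal (Dom C f)" "terminal (Cod C f)"
proof -
  have 1: "terminal (Dom C f)" if "terminal (Cod C f)" "iso C f" for f
    unfolding terminal_def
  proof (intro conjI allI impI)
    show "Dom C f \<in> Obj C" using that by simp
    fix X g h
    assume gh: "g \<in> Hom C X (Dom C f)" "h \<in> Hom C X (Dom C f)"
    then have "f \<cdot> g \<in> Hom C X (Cod C f)" "f \<cdot> h \<in> Hom C X (Cod C f)"
      using that by (auto simp: Hom_def)
    then have "f \<cdot> g = f \<cdot> h"
      using that(1) unfolding terminal_def by blast
    then show "g = h"
      by (rule iso_mono[OF that(2), rotated 4]) (use gh in \<open>auto simp: Hom_def\<close>)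
  qed
  have "iso C (Inv C f)"
    unfolding iso_def inverse_arrows_def by (rule exI[of _ f]) (use assms(1) in \<open>simp add: Hom_def\<close>)
  with 1[of f] 1[of "Inv C f"] assms show "terminal (Dom C f)" "terminal (Cod C f)"
    by auto
qed

lemma terminal_unit_unit: "terminal (UnitO C \<odot> UnitO C)"
  using terminal_iso(1)[of "LUnit C (UnitO C)"] terminal_unit by simp

lemma terminal_unit4: "terminal ((UnitO C \<odot> UnitO C) \<odot> (UnitO C \<odot> UnitO C))"
proof -
  have "iso C (LUnit C (UnitO C) \<otimes> LUnit C (UnitO C))"
    by (simp add: iso_tens)
  from terminal_iso(1)[OF this] show ?thesis
    using terminal_unit_unit by simp
qed

lemma terminal_eq:
  "\<lbrakk>terminal T; f \<in> Arr C; g \<in> Arr C; Dom C f = Dom C g; Cod C f = T; Cod C g = T\<rbrakk> \<Longrightarrow> f = g"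
  unfolding terminal_def Hom_def by blast

lemma deterministic_comp:
  assumes "deterministic C f" "deterministic C g" "Dom C g = Cod C f"
  shows "deterministic C (g \<cdot> f)"
proof -
  have [simp]: "f \<in> Arr C" "g \<in> Arr C" "Dom C g = Cod C f"
    using assms by (auto simp: deterministic_def)
  have "Copy C (Cod C g) \<cdot> (g \<cdot> f) = Copy C (Cod C g) \<cdot> g \<cdot> f"
    by simp
  also have "\<dots> = (g \<otimes> g) \<cdot> (Copy C (Cod C f) \<cdot> f)"
    using assms by (simp add: deterministic_def)
  also have "\<dots> = ((g \<cdot> f) \<otimes> (g \<cdot> f)) \<cdot> Copy C (Dom C f)"
    using assms by (simp add: deterministic_def)
  finally show ?thesis
    by (simp add: deterministic_def)
qed

text \<open>The two arrows to be compared agree after composition with \<open>f \<otimes> f\<close>,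
  by determinism of \<open>f\<close>, and \<open>f \<otimes> f\<close> is invertible.\<close>

lemma deterministic_inv:
  assumes "iso C f" "deterministic C f"
  shows "deterministic C (Inv C f)"
proof -
  have "iso C (f \<otimes> f)"
    using assms(1) by (simp add: iso_tens)
  moreover have "(f \<otimes> f) \<cdot> (Copy C (Dom C f) \<cdot> Inv C f) = (f \<otimes> f) \<cdot> ((Inv C f \<otimes> Inv C f) \<cdot> Copy C (Cod C f))"
  proof -
    have "(f \<otimes> f) \<cdot> (Copy C (Dom C f) \<cdot> Inv C f) = (f \<otimes> f) \<cdot> Copy C (Dom C f) \<cdot> Inv C f"
      using assms by simp
    also have "\<dots> = Copy C (Cod C f) \<cdot> f \<cdot> Inv C f"
      using assms by (simp add: deterministic_def)
    finally show ?thesis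
      using assms by simp
  qed
  ultimately show ?thesis
    unfolding deterministic_def using assms(1) iso_mono[of "f \<otimes> f"] by (simp del: tens_comp_assoc)
qed

lemma copy_tens_four_swap:
  "\<lbrakk>X \<in> Obj C; Y \<in> Obj C\<rbrakk> \<Longrightarrow> Copy C (X \<odot> Y) = four_swap X X Y Y \<cdot> (Copy C X \<otimes> Copy C Y)"
  using copy_tens middle_swap_eq by simp

lemma deterministic_tens:
  assumes "deterministic C f" "deterministic C g"
  shows "deterministic C (f \<otimes> g)"
proof -
  have [simp]: "f \<in> Arr C" "g \<in> Arr C"
    using assms by (auto simp: deterministic_def)
  have "Copy C (Cod C f \<odot> Cod C g) \<cdot> (f \<otimes> g) =
      four_swap (Cod C f) (Cod C f) (Cod C g) (Cod C g) \<cdot> ((Copy C (Cod C f) \<cdot> f) \<otimes> (Copy C (Cod C g) \<cdot> g))"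
    by (simp add: copy_tens_four_swap)
  also have "\<dots> = four_swap (Cod C f) (Cod C f) (Cod C g) (Cod C g) \<cdot>
      ((f \<otimes> f) \<otimes> (g \<otimes> g)) \<cdot> (Copy C (Dom C f) \<otimes> Copy C (Dom C g))"
    using assms by (simp add: deterministic_def)
  also have "\<dots> = ((f \<otimes> g) \<otimes> (f \<otimes> g)) \<cdot> Copy C (Dom C f \<odot> Dom C g)"
    unfolding four_swap_natural[OF \<open>f \<in> Arr C\<close> \<open>f \<in> Arr C\<close> \<open>g \<in> Arr C\<close> \<open>g \<in> Arr C\<close>]
    by (simp add: copy_tens_four_swap)
  finally show ?thesis
    by (simp add: deterministic_def)
qed

lemma deterministic_copy_unit: "deterministic C (Copy C (UnitO C))"
  unfolding deterministic_def by (simp add: terminal_eq[OF terminal_unit4])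

lemma deterministic_discard: "X \<in> Obj C \<Longrightarrow> deterministic C (Discard C X)"
  unfolding deterministic_def by (simp add: terminal_eq[OF terminal_unit_unit])

lemma deterministic_ident: "X \<in> Obj C \<Longrightarrow> deterministic C (Ident C X)"
  by (simp add: deterministic_def)

text \<open>Two unit wires cannot be told apart: their swap is an endomorphism of the terminal
  object \<open>I \<odot> I\<close>, hence the identity, and the associators around it
  cancel.\<close>

lemma four_swap_units:
  assumes [simp]: "X \<in> Obj C" "Y \<in> Obj C"
  shows "four_swap X (UnitO C) (UnitO C) Y = Ident C ((X \<odot> UnitO C) \<odot> (UnitO C \<odot> Y))"
proof -
  have "Swap C (UnitO C) (UnitO C) = Ident C (UnitO C \<odot> UnitO C)"
    by (rule terminal_eq[OF terminal_unit_unit]) auto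
  then show ?thesis
    by (simp add: four_swap_def)
qed

text \<open>Naturality moves the discards through the \<open>four_swap\<close> inside
  \<open>Copy C (X \<odot> Y)\<close>. It then exchanges two units only and disappears, leaving one
  counit law for each factor.\<close>

lemma copy_project:
  assumes [simp]: "X \<in> Obj C" "Y \<in> Obj C"
  shows "((RUnit C X \<cdot> (Ident C X \<otimes> Discard C Y)) \<otimes> (LUnit C Y \<cdot> (Discard C X \<otimes> Ident C Y))) \<cdot>
    Copy C (X \<odot> Y) = Ident C (X \<odot> Y)"
proof -
  have "((Ident C X \<otimes> Discard C Y) \<otimes> (Discard C X \<otimes> Ident C Y)) \<cdot> four_swap X X Y Y =
      four_swap X (UnitO C) (UnitO C) Y \<cdot> ((Ident C X \<otimes> Discard C X) \<otimes> (Discard C Y \<otimes> Ident C Y))"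
    using four_swap_natural[of "Ident C X" "Discard C X" "Discard C Y" "Ident C Y"] by simp
  then have *: "((Ident C X \<otimes> Discard C Y) \<otimes> (Discard C X \<otimes> Ident C Y)) \<cdot> four_swap X X Y Y =
      (Ident C X \<otimes> Discard C X) \<otimes> (Discard C Y \<otimes> Ident C Y)"
    by (simp add: four_swap_units)
  have "((RUnit C X \<cdot> (Ident C X \<otimes> Discard C Y)) \<otimes> (LUnit C Y \<cdot> (Discard C X \<otimes> Ident C Y))) \<cdot> Copy C (X \<odot> Y) =
    (RUnit C X \<otimes> LUnit C Y) \<cdot> (((Ident C X \<otimes> Discard C Y) \<otimes> (Discard C X \<otimes> Ident C Y)) \<cdot> four_swap X X Y Y \<cdot>
      (Copy C X \<otimes> Copy C Y))"
    by (simp add: copy_tens_four_swap)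
  also have "\<dots> = Ident C (X \<odot> Y)"
    unfolding * using copy_counit_left[of Y] copy_counit_right[of X] by simp
  finally show ?thesis .
qed

lemma sharp_stateD:
  assumes "sharp_state C X s"
  shows "s \<in> Arr C" "Dom C s = UnitO C" "Cod C s = X" "X \<in> Obj C" "deterministic C s"
  using assms by (auto simp: sharp_state_def Hom_def)

lemma sharp_stateI:
  "\<lbrakk>deterministic C s; Dom C s = UnitO C; Cod C s = X\<rbrakk> \<Longrightarrow> sharp_state C X s"
  by (simp add: sharp_state_def Hom_def deterministic_def)

lemma sharp_state_comp:
  "\<lbrakk>sharp_state C X s; deterministic C f; Dom C f = X\<rbrakk> \<Longrightarrow> sharp_state C (Cod C f) (f \<cdot> s)"
  using sharp_stateD[of X s] by (intro sharp_stateI deterministic_comp) (auto simp: deterministic_def)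

text \<open>\<open>Copy C (UnitO C)\<close> serves as the arrow from \<open>I\<close> to
  \<open>I \<odot> I\<close>. It is the form that determinism of a state produces, and it equals any
  other such arrow because \<open>I \<odot> I\<close> is terminal.\<close>

lemma sharp_state_pair:
  assumes "sharp_state C X s" "sharp_state C Y t"
  shows "sharp_state C (X \<odot> Y) ((s \<otimes> t) \<cdot> Copy C (UnitO C))"
  using sharp_stateD[OF assms(1)] sharp_stateD[OF assms(2)]
  by (intro sharp_stateI deterministic_comp deterministic_tens deterministic_copy_unit) auto

text \<open>The unit axioms do not mention copying, so this goes through \<open>copy_tens\<close>:
  \<open>four_swap_runit\<close> reduces the claim to naturality of the unitor at
  \<open>Copy C X\<close>, and copying on the unit is undone by its unitor.\<close>

lemma deterministic_runit:
  assumes [simp]: "X \<in> Obj C"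
  shows "deterministic C (RUnit C X)"
proof -
  let ?I = "UnitO C"
  have u: "LUnit C ?I \<cdot> Copy C ?I = Ident C ?I"
    by (rule terminal_eq[OF terminal_unit]) auto
  have "(RUnit C X \<otimes> RUnit C X) \<cdot> Copy C (X \<odot> ?I) =
      (RUnit C X \<otimes> RUnit C X) \<cdot> four_swap X X ?I ?I \<cdot> (Copy C X \<otimes> Copy C ?I)"
    by (simp add: copy_tens_four_swap)
  also have "\<dots> = RUnit C (X \<odot> X) \<cdot> (Copy C X \<otimes> Ident C ?I)"
    by (simp only: four_swap_runit assms) (simp add: u)
  also have "\<dots> = Copy C X \<cdot> RUnit C X"
    by (rule runit_natural) (simp add: Hom_def)
  finally show ?thesis
    by (simp add: deterministic_def)
qed

lemma deterministic_lunit: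
  assumes [simp]: "X \<in> Obj C"
  shows "deterministic C (LUnit C X)"
proof -
  let ?I = "UnitO C"
  have u: "LUnit C ?I \<cdot> Copy C ?I = Ident C ?I"
    by (rule terminal_eq[OF terminal_unit]) auto
  have "(LUnit C X \<otimes> LUnit C X) \<cdot> Copy C (?I \<odot> X) =
      (LUnit C X \<otimes> LUnit C X) \<cdot> four_swap ?I ?I X X \<cdot> (Copy C ?I \<otimes> Copy C X)"
    by (simp add: copy_tens_four_swap)
  also have "\<dots> = LUnit C (X \<odot> X) \<cdot> (Ident C ?I \<otimes> Copy C X)"
    by (simp only: four_swap_lunit assms) (simp add: u)
  also have "\<dots> = Copy C X \<cdot> LUnit C X"
    by (rule lunit_natural) (simp add: Hom_def)
  finally show ?thesis
    by (simp add: deterministic_def)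
qed

text \<open>
  Copying a state of \<open>X \<odot> Y\<close> and projecting the two copies to \<open>X\<close> and \<open>Y\<close> gives the state back; if the
  state is deterministic, the two copies are independent, so it is the product of its marginals.
\<close>

lemma sharp_state_tensE:
  assumes "sharp_state C (X \<odot> Y) t" and [simp]: "X \<in> Obj C" "Y \<in> Obj C"
  obtains t1 t2 where "sharp_state C X t1" "sharp_state C Y t2" "t = (t1 \<otimes> t2) \<cdot> Copy C (UnitO C)"
proof
  let ?p = "RUnit C X \<cdot> (Ident C X \<otimes> Discard C Y)"
  let ?q = "LUnit C Y \<cdot> (Discard C X \<otimes> Ident C Y)"
  note [simp] = sharp_stateD[OF assms(1)]
  have eq: "t = ((?p \<cdot> t) \<otimes> (?q \<cdot> t)) \<cdot> Copy C (UnitO C)"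
  proof -
    have "t = (?p \<otimes> ?q) \<cdot> Copy C (X \<odot> Y) \<cdot> t"
      by (subst copy_project) auto
    also have "\<dots> = (?p \<otimes> ?q) \<cdot> (Copy C (X \<odot> Y) \<cdot> t)"
      by simp
    also have "Copy C (X \<odot> Y) \<cdot> t = (t \<otimes> t) \<cdot> Copy C (UnitO C)"
      using sharp_stateD(5)[OF assms(1)] by (simp add: deterministic_def)
    finally show ?thesis
      by simp
  qed
  show "t = ((?p \<cdot> t) \<otimes> (?q \<cdot> t)) \<cdot> Copy C (UnitO C)" by (fact eq)
  have "deterministic C ?p" "deterministic C ?q"
    by (auto intro!: deterministic_comp deterministic_tens deterministic_ident deterministic_discard
        deterministic_runit deterministic_lunit)
  then show "sharp_state C X (?p \<cdot> t)" "sharp_state C Y (?q \<cdot> t)"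
    using sharp_state_comp[OF assms(1), of ?p] sharp_state_comp[OF assms(1), of ?q] by auto
qed

end

section \<open>Free Markov categories and models\<close>

lemma dclass_eqI: "deq Q a b \<Longrightarrow> dclass Q a = dclass Q b"
  unfolding dclass_def by (auto intro: deq.sym deq.trans)

context
  fixes Q :: "('t, 'q) qsig"
  assumes sig: "query_signature Q"
begin

lemma dwf_lists: "dwf Q d \<Longrightarrow> ddom Q d \<in> lists (qtypes Q) \<and> dcod Q d \<in> lists (qtypes Q)"
  using sig by (induction d) (auto simp: query_signature_def)

text \<open>\<open>Dom\<close>, \<open>Cod\<close> and the operations on classes work on a
  representative picked by \<open>drep\<close>; this invariance makes the choice immaterial for
  types.\<close>

lemma deq_types:
  "deq Q a b \<Longrightarrow> dwf Q a \<and> dwf Q b \<and> ddom Q a = ddom Q b \<and> dcod Q a = dcod Q b"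
  by (induction rule: deq.induct) (use dwf_lists in \<open>auto\<close>)

lemma deq_drep: "dwf Q d \<Longrightarrow> deq Q d (drep (dclass Q d))"
  unfolding drep_def dclass_def by (rule someI2[of _ d]) (auto intro: deq.refl)

lemma free_markov_simps [simp]:
  "Obj (free_markov Q) = lists (qtypes Q)"
  "Ident (free_markov Q) xs = dclass Q (DId xs)"
  "TensO (free_markov Q) = (@)"
  "UnitO (free_markov Q) = []"
  "Assoc (free_markov Q) xs ys zs = dclass Q (DId (xs @ ys @ zs))"
  "LUnit (free_markov Q) xs = dclass Q (DId xs)"
  "RUnit (free_markov Q) xs = dclass Q (DId xs)"
  "Swap (free_markov Q) xs ys = dclass Q (DSwap xs ys)"
  "Copy (free_markov Q) xs = dclass Q (DCopy xs)"
  "Discard (free_markov Q) xs = dclass Q (DDiscard xs)"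
  by (simp_all add: free_markov_def)

lemma free_markov_types:
  assumes "dwf Q d"
  shows "dclass Q d \<in> Arr (free_markov Q)"
    "Dom (free_markov Q) (dclass Q d) = ddom Q d" "Cod (free_markov Q) (dclass Q d) = dcod Q d"
  using assms deq_types[OF deq_drep[OF assms]] by (auto simp: free_markov_def)

lemma free_markov_HomI:
  "\<lbrakk>dwf Q d; ddom Q d = xs; dcod Q d = ys\<rbrakk> \<Longrightarrow> dclass Q d \<in> Hom (free_markov Q) xs ys"
  using free_markov_types by (simp add: Hom_def)

lemma free_markov_HomE:
  assumes "f \<in> Hom (free_markov Q) xs ys"
  obtains d where "f = dclass Q d" "dwf Q d" "ddom Q d = xs" "dcod Q d = ys"
proof -
  from assms obtain d where "f = dclass Q d" "dwf Q d"
    by (auto simp: Hom_def free_markov_def)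
  with assms show thesis
    using free_markov_types that by (auto simp: Hom_def)
qed

lemma free_markov_comp:
  assumes "dwf Q g" "dwf Q f" "dcod Q f = ddom Q g"
  shows "Comp (free_markov Q) (dclass Q g) (dclass Q f) = dclass Q (DComp g f)"
proof -
  have "deq Q (DComp g f) (DComp (drep (dclass Q g)) (drep (dclass Q f)))"
    using assms by (intro deq.comp_cong deq_drep)
  then show ?thesis
    using assms by (simp add: free_markov_def dclass_eqI)
qed

lemma free_markov_tens:
  assumes "dwf Q f" "dwf Q g"
  shows "TensA (free_markov Q) (dclass Q f) (dclass Q g) = dclass Q (DTens f g)"
proof -
  have "deq Q (DTens f g) (DTens (drep (dclass Q f)) (drep (dclass Q g)))"
    using assms by (intro deq.tens_cong deq_drep)
  then show ?thesis
    using assms by (simp add: free_markov_def dclass_eqI)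
qed

end

locale query_model = markov_category C
  for C :: "('o, 'm) markov_cat" (structure) +
  fixes Q :: "('t, 'q) qsig" and M :: "('t, 'q, 'o, 'm) qmodel"
  assumes model: "model C Q M"
begin

lemma sig: "query_signature Q" and M: "markov_functor (free_markov Q) C M"
  using model by (auto simp: model_def)

sublocale M: markov_functor "free_markov Q" C M
  by (rule M)

abbreviation T :: "'t list set" where "T \<equiv> lists (qtypes Q)"

lemma obj [simp]: "xs \<in> T \<Longrightarrow> FObj M xs \<in> Obj C"
  using M.f_obj by (simp add: free_markov_simps[OF sig])

lemma mult_simps [simp]:
  assumes "xs \<in> T" "ys \<in> T"
  shows "iso C (FMult M xs ys)" "FMult M xs ys \<in> Arr C"
    "Dom C (FMult M xs ys) = FObj M xs \<odot> FObj M ys" "Cod C (FMult M xs ys) = FObj M (xs @ ys)"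
  using assms M.mult_iso[of xs ys] M.mult_hom[of xs ys] by (auto simp: free_markov_simps[OF sig] Hom_def)

lemma unit_simps [simp]:
  "iso C (FUnit M)" "FUnit M \<in> Arr C" "Dom C (FUnit M) = UnitO C" "Cod C (FUnit M) = FObj M []"
  using M.unit_iso M.unit_hom by (auto simp: free_markov_simps[OF sig] Hom_def)

text \<open>\<open>FUnit M\<close> is an isomorphism from the unit. All equations about discarding
  in a model reduce to this.\<close>

lemma terminal_empty: "terminal (FObj M [])"
  using terminal_iso(2)[of "FUnit M"] terminal_unit by simp

lemma arr_id: "xs \<in> T \<Longrightarrow> FArr M (dclass Q (DId xs)) = Ident C (FObj M xs)"
  using M.f_id[of xs] by (simp add: free_markov_simps[OF sig])

lemma mult_assoc:
  assumes "xs \<in> T" "ys \<in> T" "zs \<in> T"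
  shows "FMult M (xs @ ys) zs \<cdot> (FMult M xs ys \<otimes> Ident C (FObj M zs)) =
    FMult M xs (ys @ zs) \<cdot> ((Ident C (FObj M xs) \<otimes> FMult M ys zs) \<cdot> Assoc C (FObj M xs) (FObj M ys) (FObj M zs))"
  using M.mult_assoc[of xs ys zs] assms by (simp add: free_markov_simps[OF sig] arr_id)

text \<open>The value of a tensor of diagrams has \<open>FMult\<close> on its outputs and inverses
  of it on its inputs; this is the associativity law needed on the input side.\<close>

lemma mult_assoc_inv:
  assumes [simp]: "xs \<in> T" "ys \<in> T" "zs \<in> T"
  shows "Assoc C (FObj M xs) (FObj M ys) (FObj M zs) \<cdot>
      ((Inv C (FMult M xs ys) \<otimes> Ident C (FObj M zs)) \<cdot> Inv C (FMult M (xs @ ys) zs)) =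
    (Ident C (FObj M xs) \<otimes> Inv C (FMult M ys zs)) \<cdot> Inv C (FMult M xs (ys @ zs))" (is "?a \<cdot> ?k = ?r")
proof -
  have "?a \<cdot> ?k = ?r \<cdot> (FMult M xs (ys @ zs) \<cdot> ((Ident C (FObj M xs) \<otimes> FMult M ys zs) \<cdot> ?a)) \<cdot> ?k"
    by simp
  also have "\<dots> = ?r"
    unfolding mult_assoc[OF assms, symmetric] by simp
  finally show ?thesis .
qed

lemma mult_unit_left:
  assumes "xs \<in> T"
  shows "FMult M [] xs \<cdot> (FUnit M \<otimes> Ident C (FObj M xs)) = LUnit C (FObj M xs)"
  using M.mult_lunit[of xs] assms by (simp add: free_markov_simps[OF sig] arr_id)

lemma mult_unit_right:
  assumes "xs \<in> T"
  shows "FMult M xs [] \<cdot> (Ident C (FObj M xs) \<otimes> FUnit M) = RUnit C (FObj M xs)"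
  using M.mult_runit[of xs] assms by (simp add: free_markov_simps[OF sig] arr_id)

text \<open>\<open>mult_natural\<close> covers only arrows in the image of \<open>M\<close>, but
  here \<open>f\<close> is any arrow of \<open>C\<close>, as is needed for values of other queries.
  It holds because \<open>FMult M [] xs\<close> is the left unitor up to \<open>FUnit M\<close>,
  which is invertible.\<close>

lemma mult_unit_left_natural:
  assumes [simp]: "xs \<in> T" "ys \<in> T" and f: "f \<in> Hom C (FObj M xs) (FObj M ys)"
  shows "FMult M [] ys \<cdot> (Ident C (FObj M []) \<otimes> f) = f \<cdot> FMult M [] xs"
proof (rule iso_epi)
  note HomD[OF f, simp]
  show "iso C (FUnit M \<otimes> Ident C (FObj M xs))"
    by (intro iso_tens) auto
  have "FMult M [] ys \<cdot> (Ident C (FObj M []) \<otimes> f) \<cdot> (FUnit M \<otimes> Ident C (FObj M xs)) =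
      FMult M [] ys \<cdot> (FUnit M \<otimes> Ident C (FObj M ys)) \<cdot> (Ident C (UnitO C) \<otimes> f)"
    by simp
  also have "\<dots> = f \<cdot> FMult M [] xs \<cdot> (FUnit M \<otimes> Ident C (FObj M xs))"
    using mult_unit_left[of xs] lunit_natural[OF f] mult_unit_left[of ys] by (simp del: tens_comp)
  finally show "FMult M [] ys \<cdot> (Ident C (FObj M []) \<otimes> f) \<cdot> (FUnit M \<otimes> Ident C (FObj M xs)) =
      f \<cdot> FMult M [] xs \<cdot> (FUnit M \<otimes> Ident C (FObj M xs))" .
qed (use HomD[OF f] in auto)

lemma mult_unit_right_natural:
  assumes [simp]: "xs \<in> T" "ys \<in> T" and f: "f \<in> Hom C (FObj M xs) (FObj M ys)"
  shows "FMult M ys [] \<cdot> (f \<otimes> Ident C (FObj M [])) = f \<cdot> FMult M xs []"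
proof (rule iso_epi)
  note HomD[OF f, simp]
  show "iso C (Ident C (FObj M xs) \<otimes> FUnit M)"
    by (intro iso_tens) auto
  have "FMult M ys [] \<cdot> (f \<otimes> Ident C (FObj M [])) \<cdot> (Ident C (FObj M xs) \<otimes> FUnit M) =
      FMult M ys [] \<cdot> (Ident C (FObj M ys) \<otimes> FUnit M) \<cdot> (f \<otimes> Ident C (UnitO C))"
    by simp
  also have "\<dots> = f \<cdot> FMult M xs [] \<cdot> (Ident C (FObj M xs) \<otimes> FUnit M)"
    using mult_unit_right[of xs] runit_natural[OF f] mult_unit_right[of ys] by (simp del: tens_comp)
  finally show "FMult M ys [] \<cdot> (f \<otimes> Ident C (FObj M [])) \<cdot> (Ident C (FObj M xs) \<otimes> FUnit M) =
      f \<cdot> FMult M xs [] \<cdot> (Ident C (FObj M xs) \<otimes> FUnit M)" .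
qed (use HomD[OF f] in auto)

lemma arr_hom: "dwf Q d \<Longrightarrow> FArr M (dclass Q d) \<in> Hom C (FObj M (ddom Q d)) (FObj M (dcod Q d))"
  by (intro M.f_hom free_markov_HomI[OF sig]) auto

text \<open>Uniqueness half of freeness: the functor laws, solved for the value of each constructor
  by inverting \<open>FMult\<close>, are the clauses of \<open>diag_value\<close>.\<close>

lemma diag_value_eq_arr:
  "dwf Q d \<Longrightarrow> diag_value C M Q (\<lambda>q. FArr M (gen Q q)) d = FArr M (dclass Q d)"
proof (induction d)
  case (DGen q)
  then show ?case by (simp add: gen_def)
next
  case (DId xs)
  then show ?case by (simp add: arr_id)
next
  case (DComp g f)
  then show ?case
    using M.f_comp[OF free_markov_HomI[OF sig, OF _ HOL.refl HOL.refl] free_markov_HomI[OF sig], of f g "dcod Q g"]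
    by (simp add: free_markov_comp[OF sig])
next
  case (DTens f g)
  then have [simp]: "ddom Q f \<in> T" "ddom Q g \<in> T" "dcod Q f \<in> T" "dcod Q g \<in> T" "dwf Q f" "dwf Q g"
    using dwf_lists[OF sig] by auto
  note [simp] = HomD[OF arr_hom[of "DTens f g"], simplified]
  have "FArr M (dclass Q (DTens f g)) \<cdot> FMult M (ddom Q f) (ddom Q g) =
      FMult M (dcod Q f) (dcod Q g) \<cdot> (FArr M (dclass Q f) \<otimes> FArr M (dclass Q g))"
    using M.mult_natural[OF free_markov_HomI[OF sig, OF _ HOL.refl HOL.refl] free_markov_HomI[OF sig, OF _ HOL.refl HOL.refl], of f g]
    by (simp add: free_markov_tens[OF sig])
  then have "FArr M (dclass Q (DTens f g)) \<cdot> FMult M (ddom Q f) (ddom Q g) \<cdot> Inv C (FMult M (ddom Q f) (ddom Q g)) =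
      FMult M (dcod Q f) (dcod Q g) \<cdot> (FArr M (dclass Q f) \<otimes> FArr M (dclass Q g)) \<cdot> Inv C (FMult M (ddom Q f) (ddom Q g))"
    by simp
  then show ?case
    using DTens HomD[OF arr_hom[of f]] HomD[OF arr_hom[of g]] by simp
next
  case (DSwap xs ys)
  then have [simp]: "xs \<in> T" "ys \<in> T"
    by auto
  note [simp] = HomD[OF arr_hom[of "DSwap xs ys"], simplified]
  have "FArr M (dclass Q (DSwap xs ys)) \<cdot> FMult M xs ys \<cdot> Inv C (FMult M xs ys) =
      FMult M ys xs \<cdot> Swap C (FObj M xs) (FObj M ys) \<cdot> Inv C (FMult M xs ys)"
    using M.mult_swap[of xs ys] by (simp add: free_markov_simps[OF sig])
  then show ?case by simp
next
  case (DCopy xs)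
  then show ?case
    using M.f_copy[of xs] by (simp add: free_markov_simps[OF sig])
next
  \<comment> \<open>Preservation of discarding is not an axiom of \<open>markov_functor\<close>; it
    follows since both sides end in the terminal object \<open>FObj M []\<close>.\<close>
  case (DDiscard xs)
  then show ?case
    using HomD[OF arr_hom[of "DDiscard xs"]] by (intro terminal_eq[OF terminal_empty]) simp_all
qed

text \<open>
  The axioms of \<open>deq\<close> that contain no arbitrary diagram mention no query. Hence the equations of values
  that they yield over \<open>Q\<close> are literally those over any other signature with the same types.
\<close>

lemma structural_eq:
  "deq Q a b \<Longrightarrow> diag_value C M Q (\<lambda>q. FArr M (gen Q q)) a = diag_value C M Q (\<lambda>q. FArr M (gen Q q)) b"
  using deq_types[OF sig, of a b] dclass_eqI[of Q a b] by (simp add: diag_value_eq_arr)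

section \<open>Evaluation of diagrams over another signature with the same types\<close>

context
  fixes Q' :: "('t, 'p) qsig" and v :: "'p \<Rightarrow> 'm"
  assumes sig': "query_signature Q'" and qtypes: "qtypes Q' = qtypes Q"
    and v: "\<And>q. q \<in> queries Q' \<Longrightarrow> v q \<in> Hom C (FObj M (qin Q' q)) (FObj M (qout Q' q))"
begin

abbreviation "val \<equiv> diag_value C M Q' v"

lemma lists: "dwf Q' d \<Longrightarrow> ddom Q' d \<in> T \<and> dcod Q' d \<in> T"
  using dwf_lists[OF sig'] qtypes by simp

lemma val_hom: "dwf Q' d \<Longrightarrow> val d \<in> Hom C (FObj M (ddom Q' d)) (FObj M (dcod Q' d))"
proof (induction d)
  case (DTens f g)
  then show ?case
    using lists[of f] lists[of g] by (simp add: Hom_def)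
qed (use v in \<open>auto simp: Hom_def qtypes\<close>)

lemma val_simps [simp]:
  assumes "dwf Q' d"
  shows "val d \<in> Arr C" "Dom C (val d) = FObj M (ddom Q' d)" "Cod C (val d) = FObj M (dcod Q' d)"
    "ddom Q' d \<in> T" "dcod Q' d \<in> T"
  using HomD[OF val_hom[OF assms]] lists[OF assms] by auto

text \<open>Tensoring is strict for diagrams but not in \<open>C\<close>: the associator produced on
  the outputs slides through the three values and is absorbed on the inputs by
  \<open>mult_assoc_inv\<close>.\<close>

lemma val_tens_assoc:
  assumes [simp]: "dwf Q' f" "dwf Q' g" "dwf Q' h"
  shows "val (DTens (DTens f g) h) = val (DTens f (DTens g h))"
proof -
  let ?xf = "ddom Q' f" and ?xg = "ddom Q' g" and ?xh = "ddom Q' h"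
  let ?yf = "dcod Q' f" and ?yg = "dcod Q' g" and ?yh = "dcod Q' h"
  let ?k = "(Inv C (FMult M ?xf ?xg) \<otimes> Ident C (FObj M ?xh)) \<cdot> Inv C (FMult M (?xf @ ?xg) ?xh)"
  have "val (DTens (DTens f g) h) = FMult M (?yf @ ?yg) ?yh \<cdot> (FMult M ?yf ?yg \<otimes> Ident C (FObj M ?yh)) \<cdot>
      (((val f \<otimes> val g) \<otimes> val h) \<cdot> ?k)"
    by simp
  also have "\<dots> = FMult M ?yf (?yg @ ?yh) \<cdot> ((Ident C (FObj M ?yf) \<otimes> FMult M ?yg ?yh) \<cdot>
      (Assoc C (FObj M ?yf) (FObj M ?yg) (FObj M ?yh) \<cdot> ((val f \<otimes> val g) \<otimes> val h) \<cdot> ?k))"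
    by (subst mult_assoc) auto
  also have "Assoc C (FObj M ?yf) (FObj M ?yg) (FObj M ?yh) \<cdot> ((val f \<otimes> val g) \<otimes> val h) =
      (val f \<otimes> (val g \<otimes> val h)) \<cdot> Assoc C (FObj M ?xf) (FObj M ?xg) (FObj M ?xh)"
    using assoc_natural'[of "val f" "val g" "val h"] by simp
  also have "\<dots> \<cdot> ?k = (val f \<otimes> (val g \<otimes> val h)) \<cdot> (Assoc C (FObj M ?xf) (FObj M ?xg) (FObj M ?xh) \<cdot> ?k)"
    by simp
  also have "Assoc C (FObj M ?xf) (FObj M ?xg) (FObj M ?xh) \<cdot> ?k =
      (Ident C (FObj M ?xf) \<otimes> Inv C (FMult M ?xg ?xh)) \<cdot> Inv C (FMult M ?xf (?xg @ ?xh))"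
    by (rule mult_assoc_inv) auto
  finally show ?thesis
    by simp
qed

text \<open>Soundness of \<open>deq\<close>. Without it the value of a class would depend on the
  representative that \<open>drep\<close> selects.\<close>

lemma val_deq: "deq Q' a b \<Longrightarrow> val a = val b"
proof (induction rule: deq.induct)
  case (refl f)
  show ?case ..
next
  case (sym f g)
  then show ?case by simp
next
  case (trans f g h)
  then show ?case by simp
next
  case (comp_cong g g' f f')
  then show ?case by simp
next
  case (tens_cong f f' g g')
  then show ?case
    using deq_types[OF sig'] by simp
next
  case (id_left f)
  then show ?case by simp
next
  case (id_right f)
  then show ?case by simp
next
  case (comp_assoc h g f)
  then show ?case by simp
next
  case (tens_id xs ys)
  then show ?case by (simp add: qtypes)
next
  case (interchange g f g' f')
  then show ?case by simp
next
  case (tens_assoc f g h)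
  then show ?case by (rule val_tens_assoc)
next
  case (tens_unit_left f)
  then show ?case
    using arg_cong[OF mult_unit_left_natural[OF _ _ val_hom, of f], of "\<lambda>k. k \<cdot> Inv C (FMult M [] (ddom Q' f))"]
    by simp
next
  case (tens_unit_right f)
  then show ?case
    using arg_cong[OF mult_unit_right_natural[OF _ _ val_hom, of f], of "\<lambda>k. k \<cdot> Inv C (FMult M (ddom Q' f) [])"]
    by simp
next
  case (swap_natural f g)
  then show ?case
    using arg_cong[OF symmetric_monoidal_category.swap_natural[OF symmetric_monoidal_category_axioms val_hom val_hom, of f g],
        of "\<lambda>k. k \<cdot> Inv C (FMult M (ddom Q' f) (ddom Q' g))"]
    by simp
next
  case (swap_swap xs ys)
  with structural_eq[OF deq.swap_swap[of Q xs ys]] show ?case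
    by (simp add: qtypes)
next
  case (hexagon xs ys zs)
  with structural_eq[OF deq.hexagon[of Q xs ys zs]] show ?case
    by (simp only: diag_value.simps ddom.simps dcod.simps dwf.simps qtypes)
next
  case (copy_assoc xs)
  with structural_eq[OF deq.copy_assoc[of Q xs]] show ?case
    by (simp only: diag_value.simps ddom.simps dcod.simps dwf.simps qtypes)
next
  case (copy_counit_left xs)
  with structural_eq[OF deq.copy_counit_left[of Q xs]] show ?case
    by (simp only: diag_value.simps ddom.simps dcod.simps dwf.simps qtypes)
next
  case (copy_counit_right xs)
  with structural_eq[OF deq.copy_counit_right[of Q xs]] show ?case
    by (simp only: diag_value.simps ddom.simps dcod.simps dwf.simps qtypes)
next
  case (copy_comm xs)
  with structural_eq[OF deq.copy_comm[of Q xs]] show ?case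
    by (simp only: diag_value.simps ddom.simps dcod.simps dwf.simps qtypes)
next
  case (copy_tens xs ys)
  with structural_eq[OF deq.copy_tens[of Q xs ys]] show ?case
    by (simp only: diag_value.simps ddom.simps dcod.simps dwf.simps qtypes)
next
  case (discard_unique f)
  then show ?case
    by (intro terminal_eq[OF terminal_empty]) auto
qed

lemma val_drep: "dwf Q' d \<Longrightarrow> val (drep (dclass Q' d)) = val d"
  using val_deq[OF deq_drep[OF sig']] by simp

text \<open>Existence half of freeness: any well-typed assignment \<open>v\<close> on queries
  extends to a functor that shares objects and structure isomorphisms with \<open>M\<close>.\<close>

lemma value_functor:
  "markov_functor (free_markov Q') C
    \<lparr>FObj = FObj M, FArr = (\<lambda>c. val (drep c)), FMult = FMult M, FUnit = FUnit M\<rparr>" (is "markov_functor ?F C ?V")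
proof
  note s = free_markov_simps[OF sig'] qtypes
  show "FObj ?V X \<in> Obj C" if "X \<in> Obj ?F" for X
    using that by (simp add: s)
  show "FArr ?V f \<in> Hom C (FObj ?V X) (FObj ?V Y)" if "f \<in> Hom ?F X Y" for f X Y
    using that val_hom by (auto elim!: free_markov_HomE[OF sig'] simp: val_drep)
  show "FArr ?V (Ident ?F X) = Ident C (FObj ?V X)" if "X \<in> Obj ?F" for X
    using that by (simp add: s val_drep)
  show "FArr ?V (Comp ?F g f) = FArr ?V g \<cdot> FArr ?V f" if "f \<in> Hom ?F X Y" "g \<in> Hom ?F Y Z" for f g X Y Z
    using that by (auto elim!: free_markov_HomE[OF sig'] simp: val_drep free_markov_comp[OF sig'])
  show "FMult ?V X Y \<in> Hom C (FObj ?V X \<odot> FObj ?V Y) (FObj ?V (TensO ?F X Y))"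
    "iso C (FMult ?V X Y)" "deterministic C (FMult ?V X Y)" if "X \<in> Obj ?F" "Y \<in> Obj ?F" for X Y
    using that M.mult_det[of X Y] by (auto simp: s free_markov_simps[OF sig] Hom_def)
  show "FArr ?V (TensA ?F f g) \<cdot> FMult ?V X Y = FMult ?V X' Y' \<cdot> (FArr ?V f \<otimes> FArr ?V g)"
    if "f \<in> Hom ?F X X'" "g \<in> Hom ?F Y Y'" for f g X Y X' Y'
    using that by (auto elim!: free_markov_HomE[OF sig'] simp: val_drep free_markov_tens[OF sig'])
  show "FUnit ?V \<in> Hom C (UnitO C) (FObj ?V (UnitO ?F))" "iso C (FUnit ?V)" "deterministic C (FUnit ?V)"
    using M.unit_det by (auto simp: s Hom_def)
  show "FArr ?V (Assoc ?F X Y Z) \<cdot> FMult ?V (TensO ?F X Y) Z \<cdot> (FMult ?V X Y \<otimes> Ident C (FObj ?V Z)) =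
      FMult ?V X (TensO ?F Y Z) \<cdot> (Ident C (FObj ?V X) \<otimes> FMult ?V Y Z) \<cdot> Assoc C (FObj ?V X) (FObj ?V Y) (FObj ?V Z)"
    if "X \<in> Obj ?F" "Y \<in> Obj ?F" "Z \<in> Obj ?F" for X Y Z
    using that mult_assoc[of X Y Z] by (simp add: s val_drep)
  show "FArr ?V (LUnit ?F X) \<cdot> FMult ?V (UnitO ?F) X \<cdot> (FUnit ?V \<otimes> Ident C (FObj ?V X)) = LUnit C (FObj ?V X)"
    "FArr ?V (RUnit ?F X) \<cdot> FMult ?V X (UnitO ?F) \<cdot> (Ident C (FObj ?V X) \<otimes> FUnit ?V) = RUnit C (FObj ?V X)"
    if "X \<in> Obj ?F" for X
    using that mult_unit_left[of X] mult_unit_right[of X] by (simp_all add: s val_drep)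
  show "FArr ?V (Swap ?F X Y) \<cdot> FMult ?V X Y = FMult ?V Y X \<cdot> Swap C (FObj ?V X) (FObj ?V Y)"
    if "X \<in> Obj ?F" "Y \<in> Obj ?F" for X Y
    using that by (simp add: s val_drep)
  show "FArr ?V (Copy ?F X) = FMult ?V X X \<cdot> Copy C (FObj ?V X)" if "X \<in> Obj ?F" for X
    using that by (simp add: s val_drep)
qed

end

end

section \<open>Wire permutations under alignment\<close>

lemma Collect_Suc_Compl: "{j. Suc j \<in> - Z} = - {j. Suc j \<in> Z}"
  by auto

text \<open>Replaces the absolute offsets of the definition by a recursion on the first block,
  matching the recursion of \<open>unshuffle\<close> and \<open>nths\<close> on lists.\<close>

lemma block_positions_Cons:
  "block_positions \<pi> (x # xs) Z = (if 0 \<in> Z then {..<length (\<pi> x)} else {}) \<union>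
     (\<lambda>k. k + length (\<pi> x)) ` block_positions \<pi> xs {i. Suc i \<in> Z}"
proof -
  have "k \<in> block_positions \<pi> (x # xs) Z \<longleftrightarrow>
      0 \<in> Z \<and> k < length (\<pi> x) \<or> k \<in> (\<lambda>k. k + length (\<pi> x)) ` block_positions \<pi> xs {i. Suc i \<in> Z}" (is "_ \<longleftrightarrow> ?r") for k
  proof -
    have "k \<in> block_positions \<pi> (x # xs) Z \<longleftrightarrow> (\<exists>i<Suc (length xs). i \<in> Z \<and>
        length (concat (map \<pi> (take i (x # xs)))) \<le> k \<and> k < length (concat (map \<pi> (take (Suc i) (x # xs)))))"
      by (simp only: block_positions_def UN_iff Bex_def Int_iff lessThan_iff atLeastLessThan_iff list.size) auto
    also have "\<dots> \<longleftrightarrow> 0 \<in> Z \<and> k < length (\<pi> x) \<or> (\<exists>i<length xs. Suc i \<in> Z \<and>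
        length (\<pi> x) + length (concat (map \<pi> (take i xs))) \<le> k \<and>
        k < length (\<pi> x) + length (concat (map \<pi> (take (Suc i) xs))))"
      by (subst Ex_less_Suc2) simp
    also have "\<dots> \<longleftrightarrow> ?r"
    proof -
      have shift: "length (\<pi> x) + a \<le> k \<and> k < length (\<pi> x) + b \<longleftrightarrow>
          (\<exists>l. k = l + length (\<pi> x) \<and> a \<le> l \<and> l < b)" for a b
        by (auto intro!: exI[of _ "k - length (\<pi> x)"])
      have "l \<in> block_positions \<pi> xs {i. Suc i \<in> Z} \<longleftrightarrow> (\<exists>i<length xs. Suc i \<in> Z \<and>
          length (concat (map \<pi> (take i xs))) \<le> l \<and> l < length (concat (map \<pi> (take (Suc i) xs))))" for l
        by (simp only: block_positions_def UN_iff Bex_def Int_iff lessThan_iff atLeastLessThan_iff mem_Collect_eq) blast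
      then show ?thesis
        unfolding shift image_iff Bex_def by blast
    qed
    finally show ?thesis .
  qed
  then show ?thesis by auto
qed

lemma block_positions_Cons_shift:
  "{j. j + length (\<pi> x) \<in> block_positions \<pi> (x # xs) Z} = block_positions \<pi> xs {i. Suc i \<in> Z}"
  by (auto simp: block_positions_Cons)

lemma block_positions_Cons_head:
  "{..<length (\<pi> x)} \<inter> block_positions \<pi> (x # xs) Z = (if 0 \<in> Z then {..<length (\<pi> x)} else {})"
  by (auto simp: block_positions_Cons)

text \<open>Used for a single block, which \<open>block_positions\<close> either contains entirely
  or misses entirely.\<close>

lemma nths_head:
  assumes "{..<length l} \<inter> A = (if b then {..<length l} else {})"
  shows "nths l A = (if b then l else [])"
proof (cases b)
  case True
  then have "\<forall>i<length l. i \<in> A" using assms by auto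
  with True show ?thesis by (simp add: nths_all)
next
  case False
  then have "filter (\<lambda>p. snd p \<in> A) (zip l [0..<length l]) = []"
    using assms by (auto simp: filter_empty_conv set_zip)
  with False show ?thesis by (simp add: nths_def)
qed

lemma nths_block_positions:
  "nths (concat (map \<pi> xs)) (block_positions \<pi> xs Z) = concat (map \<pi> (nths xs Z))"
proof (induction xs arbitrary: Z)
  case (Cons x xs)
  have "nths (\<pi> x) (block_positions \<pi> (x # xs) Z) = (if 0 \<in> Z then \<pi> x else [])"
    by (rule nths_head) (rule block_positions_Cons_head)
  then show ?case
    using Cons by (simp add: nths_append nths_Cons block_positions_Cons_shift)
qed simp

lemma nths_Compl_block_positions:
  "nths (concat (map \<pi> xs)) (- block_positions \<pi> xs Z) = concat (map \<pi> (nths xs (- Z)))"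
proof (induction xs arbitrary: Z)
  case (Cons x xs)
  have "nths (\<pi> x) (- block_positions \<pi> (x # xs) Z) = (if 0 \<notin> Z then \<pi> x else [])"
    by (rule nths_head) (use block_positions_Cons_head[of \<pi> x xs Z] in \<open>auto split: if_splits\<close>)
  moreover have "{j. j + length (\<pi> x) \<in> - block_positions \<pi> (x # xs) Z} = - block_positions \<pi> xs {i. Suc i \<in> Z}"
    using block_positions_Cons_shift[of \<pi> x xs Z] by auto
  ultimately show ?case
    using Cons by (cases "0 \<in> Z") (simp_all add: nths_append nths_Cons Collect_Suc_Compl del: Compl_iff, simp_all)
qed simp

lemma unshuffle_types:
  assumes "xs \<in> lists (qtypes Q)"
  shows "dwf Q (unshuffle xs Z)" "ddom Q (unshuffle xs Z) = nths xs (- Z) @ nths xs Z"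
    "dcod Q (unshuffle xs Z) = xs"
proof -
  have l: "nths ys A \<in> lists (qtypes Q)" if "ys \<in> lists (qtypes Q)" for ys A
    using that set_nths_subset by fastforce
  have "dwf Q (unshuffle xs Z) \<and> ddom Q (unshuffle xs Z) = nths xs (- Z) @ nths xs Z \<and>
      dcod Q (unshuffle xs Z) = xs"
    using assms
  proof (induction xs arbitrary: Z)
    case (Cons x xs)
    then show ?case
      using l[of xs] by (simp add: Let_def nths_Cons Collect_Suc_Compl del: Compl_iff) (simp add: Compl_iff)
  qed simp
  then show "dwf Q (unshuffle xs Z)" "ddom Q (unshuffle xs Z) = nths xs (- Z) @ nths xs Z"
    "dcod Q (unshuffle xs Z) = xs" by auto
qed

text \<open>No axiom of \<open>deq\<close> treats swapping with the empty list. The hexagon with two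
  empty lists makes this swap idempotent, and \<open>swap_swap\<close> makes it invertible, so it is
  the identity.\<close>

lemma deq_swap_nil:
  assumes "xs \<in> lists (qtypes Q)"
  shows "deq Q (DSwap xs []) (DId xs)"
proof -
  let ?s = "DSwap xs []" and ?s' = "DSwap [] xs"
  note [trans] = deq.trans and [simp] = assms
  have "deq Q ?s (DComp (DTens (DId []) ?s) (DTens ?s (DId [])))"
    using deq.hexagon[of Q xs "[]" "[]"] by simp
  also have "deq Q \<dots> (DComp ?s ?s)"
    by (intro deq.comp_cong deq.tens_unit_left deq.tens_unit_right) auto
  finally have idem: "deq Q ?s (DComp ?s ?s)" .
  have inv: "deq Q (DComp ?s' ?s) (DId xs)"
    using deq.swap_swap[of Q xs "[]"] by simp
  have "deq Q ?s (DComp (DId xs) ?s)"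
    using deq.sym[OF deq.id_left[of Q ?s]] by simp
  also have "deq Q \<dots> (DComp (DComp ?s' ?s) ?s)"
    by (intro deq.comp_cong deq.sym[OF inv] deq.refl) auto
  also have "deq Q \<dots> (DComp ?s' (DComp ?s ?s))"
    by (intro deq.comp_assoc) auto
  also have "deq Q \<dots> (DComp ?s' ?s)"
    by (intro deq.comp_cong deq.sym[OF idem] deq.refl) auto
  also note inv
  finally show ?thesis .
qed

text \<open>In use, \<open>ys\<close> is the block that replaces one type of \<open>QH\<close>: a
  block outside the selection is skipped in one step, as \<open>unshuffle\<close> skips a single
  wire.\<close>

lemma unshuffle_append_outside:
  assumes "ys \<in> lists (qtypes Q)" "zs \<in> lists (qtypes Q)" "{..<length ys} \<inter> W = {}"
  shows "deq Q (unshuffle (ys @ zs) W) (DTens (DId ys) (unshuffle zs {i. i + length ys \<in> W}))"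
  using assms
proof (induction ys arbitrary: W rule: list.induct)
  case Nil
  then show ?case
    using assms(2) by (auto intro!: deq.sym[OF deq.tens_unit_left] unshuffle_types)
next
  case (Cons y ys)
  note [trans] = deq.trans
  let ?W = "{i. Suc i \<in> W}" and ?u = "unshuffle zs {i. i + length (y # ys) \<in> W}"
  have wf: "dwf Q ?u"
    using assms(2) by (intro unshuffle_types)
  have W: "0 \<notin> W" "{..<length ys} \<inter> ?W = {}"
    using Cons.prems(3) by auto
  have "deq Q (unshuffle (ys @ zs) ?W) (DTens (DId ys) ?u)"
    using Cons.IH[of ?W] Cons.prems assms(2) W(2) by simp
  then have "deq Q (unshuffle ((y # ys) @ zs) W) (DTens (DId [y]) (DTens (DId ys) ?u))"
    using W(1) Cons.prems(1) by (auto simp: Let_def intro!: deq.tens_cong deq.refl)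
  also have "deq Q \<dots> (DTens (DTens (DId [y]) (DId ys)) ?u)"
    using Cons.prems assms(2) wf by (intro deq.sym[OF deq.tens_assoc]) auto
  also have "deq Q \<dots> (DTens (DId (y # ys)) ?u)"
    using Cons.prems assms(2) wf deq.tens_id[of Q "[y]" ys] by (intro deq.tens_cong deq.refl) auto
  finally show ?case .
qed

text \<open>The counterpart for a selected block. \<open>unshuffle\<close> moves its wires one at a
  time past the unselected wires of \<open>zs\<close>; the hexagon fuses these moves into one swap
  with all of \<open>ys\<close>.\<close>

lemma unshuffle_append_inside:
  assumes "ys \<in> lists (qtypes Q)" "zs \<in> lists (qtypes Q)" "{..<length ys} \<subseteq> W"
    "W' = {i. i + length ys \<in> W}"
  shows "deq Q (unshuffle (ys @ zs) W)
    (DComp (DTens (DId ys) (unshuffle zs W')) (DTens (DSwap (nths zs (- W')) ys) (DId (nths zs W'))))"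
  using assms
proof (induction ys arbitrary: W rule: list.induct)
  case Nil
  note [trans] = deq.trans
  let ?A = "nths zs (- W')" and ?B = "nths zs W'" and ?u = "unshuffle zs W'"
  have l: "?A \<in> lists (qtypes Q)" "?B \<in> lists (qtypes Q)"
    using assms(2) set_nths_subset[of zs] by auto
  note u = unshuffle_types[OF assms(2), of W']
  have "deq Q (unshuffle ([] @ zs) W) (DComp ?u (DId (ddom Q ?u)))"
    using deq.sym[OF deq.id_right[OF u(1)]] Nil.prems(4) by simp
  also have "deq Q \<dots> (DComp (DTens (DId []) ?u) (DTens (DSwap ?A []) (DId ?B)))"
  proof (intro deq.comp_cong)
    show "deq Q ?u (DTens (DId []) ?u)"
      by (rule deq.sym[OF deq.tens_unit_left[OF u(1)]])
    have "deq Q (DTens (DSwap ?A []) (DId ?B)) (DTens (DId ?A) (DId ?B))"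
      using l by (intro deq.tens_cong deq.refl deq_swap_nil) auto
    also have "deq Q \<dots> (DId (?A @ ?B))"
      using l by (intro deq.tens_id) auto
    finally show "deq Q (DId (ddom Q ?u)) (DTens (DSwap ?A []) (DId ?B))"
      using u(2) by (auto intro: deq.sym)
  qed simp
  finally show ?case .
next
  case (Cons y ys)
  note [trans] = deq.trans
  let ?A = "nths zs (- W')" and ?B = "nths zs W'" and ?u = "unshuffle zs W'"
  let ?W = "{i. Suc i \<in> W}"
  have W: "0 \<in> W" "{..<length ys} \<subseteq> ?W" and W': "W' = {i. i + length ys \<in> ?W}"
    using Cons.prems(3,4) by auto
  have l [simp]: "?A \<in> lists (qtypes Q)" "?B \<in> lists (qtypes Q)" "[y] \<in> lists (qtypes Q)" "ys \<in> lists (qtypes Q)"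
    using Cons.prems(1) assms(2) set_nths_subset[of zs] by auto
  note u [simp] = unshuffle_types[OF assms(2), of W']
  have yB: "nths (ys @ zs) ?W = ys @ ?B" and A: "nths (ys @ zs) (- ?W) = ?A"
  proof -
    have "nths ys ?W = ys" "nths ys (- ?W) = []"
      using nths_head[of ys ?W True] nths_head[of ys "- ?W" False] W(2) by auto
    moreover have "{j. j + length ys \<in> - ?W} = - W'"
      using W' by auto
    ultimately show "nths (ys @ zs) ?W = ys @ ?B" "nths (ys @ zs) (- ?W) = ?A"
      by (simp_all only: nths_append W'[symmetric]) simp_all
  qed
  let ?s = "DTens (DSwap ?A ys) (DId ?B)"
  \<comment> \<open>The induction hypothesis with the wire \<open>y\<close> added on the left,
    regrouped so that both swaps act next to the same \<open>DId ?B\<close>.\<close>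
  have first: "deq Q (DTens (DId [y]) (unshuffle (ys @ zs) ?W))
    (DComp (DTens (DId (y # ys)) ?u) (DTens (DTens (DId [y]) (DSwap ?A ys)) (DId ?B)))"
  proof -
    have "deq Q (DTens (DId [y]) (unshuffle (ys @ zs) ?W))
        (DTens (DComp (DId [y]) (DId [y])) (DComp (DTens (DId ys) ?u) ?s))"
      using deq.sym[OF deq.id_left[of Q "DId [y]"]] l(3)
      by (intro deq.tens_cong Cons.IH[OF l(4) assms(2) W(2) W']) auto
    also have "deq Q \<dots> (DComp (DTens (DId [y]) (DTens (DId ys) ?u)) (DTens (DId [y]) ?s))"
      by (intro deq.interchange) (use l u in auto)
    also have "deq Q \<dots> (DComp (DTens (DTens (DId [y]) (DId ys)) ?u) (DTens (DTens (DId [y]) (DSwap ?A ys)) (DId ?B)))"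
      by (intro deq.comp_cong deq.sym[OF deq.tens_assoc]) (use l u in auto)
    also have "deq Q \<dots> (DComp (DTens (DId (y # ys)) ?u) (DTens (DTens (DId [y]) (DSwap ?A ys)) (DId ?B)))"
      using deq.tens_id[of Q "[y]" ys] l
      by (intro deq.comp_cong deq.tens_cong deq.refl) (use l u in auto)
    finally show ?thesis .
  qed
  have second: "deq Q (DTens (DSwap ?A [y]) (DId (ys @ ?B))) (DTens (DTens (DSwap ?A [y]) (DId ys)) (DId ?B))"
  proof -
    have "deq Q (DTens (DSwap ?A [y]) (DId (ys @ ?B))) (DTens (DSwap ?A [y]) (DTens (DId ys) (DId ?B)))"
      by (intro deq.tens_cong deq.refl deq.sym[OF deq.tens_id]) (use l in auto)
    also have "deq Q \<dots> (DTens (DTens (DSwap ?A [y]) (DId ys)) (DId ?B))"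
      by (intro deq.sym[OF deq.tens_assoc]) (use l in auto)
    finally show ?thesis .
  qed
  \<comment> \<open>The hexagon for \<open>?A\<close>, \<open>[y]\<close> and \<open>ys\<close>,
    read from right to left: passing \<open>y\<close> and then \<open>ys\<close> amounts to passing
    \<open>y # ys\<close>.\<close>
  have swaps: "deq Q (DComp (DTens (DTens (DId [y]) (DSwap ?A ys)) (DId ?B)) (DTens (DTens (DSwap ?A [y]) (DId ys)) (DId ?B)))
      (DTens (DSwap ?A (y # ys)) (DId ?B))"
  proof -
    have "deq Q (DComp (DTens (DTens (DId [y]) (DSwap ?A ys)) (DId ?B)) (DTens (DTens (DSwap ?A [y]) (DId ys)) (DId ?B)))
        (DTens (DComp (DTens (DId [y]) (DSwap ?A ys)) (DTens (DSwap ?A [y]) (DId ys))) (DComp (DId ?B) (DId ?B)))"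
      by (intro deq.sym[OF deq.interchange]) (use l in auto)
    also have "deq Q \<dots> (DTens (DSwap ?A (y # ys)) (DId ?B))"
      using deq.sym[OF deq.hexagon[of Q ?A "[y]" ys]] deq.id_left[of Q "DId ?B"] l
      by (intro deq.tens_cong) auto
    finally show ?thesis .
  qed
  have "deq Q (unshuffle ((y # ys) @ zs) W)
      (DComp (DTens (DId [y]) (unshuffle (ys @ zs) ?W)) (DTens (DSwap ?A [y]) (DId (ys @ ?B))))"
    using W(1) yB A deq.refl[OF unshuffle_types(1)[of "(y # ys) @ zs" Q W]] Cons.prems(1) assms(2)
    by (simp add: Let_def)
  also have "deq Q \<dots> (DComp (DComp (DTens (DId (y # ys)) ?u) (DTens (DTens (DId [y]) (DSwap ?A ys)) (DId ?B)))
      (DTens (DTens (DSwap ?A [y]) (DId ys)) (DId ?B)))"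
    using unshuffle_types(2)[of "ys @ zs" Q ?W] yB A assms(2) l by (intro deq.comp_cong first second) auto
  also have "deq Q \<dots> (DComp (DTens (DId (y # ys)) ?u) (DComp (DTens (DTens (DId [y]) (DSwap ?A ys)) (DId ?B))
      (DTens (DTens (DSwap ?A [y]) (DId ys)) (DId ?B))))"
    by (intro deq.comp_assoc) (use l u in auto)
  also have "deq Q \<dots> (DComp (DTens (DId (y # ys)) ?u) (DTens (DSwap ?A (y # ys)) (DId ?B)))"
    by (intro deq.comp_cong swaps deq.refl) (use l u in auto)
  finally show ?case .
qed

section \<open>Plugging in sharp states\<close>

context query_model
begin

lemma nths_T [simp]: "xs \<in> T \<Longrightarrow> nths xs A \<in> T"
  using set_nths_subset[of xs A] by auto

lemma query_types [simp]: "q \<in> queries Q \<Longrightarrow> qin Q q \<in> T" "q \<in> queries Q \<Longrightarrow> qout Q q \<in> T"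
  using sig by (auto simp: query_signature_def)

lemma arr_simps [simp]:
  assumes "dwf Q d"
  shows "FArr M (dclass Q d) \<in> Arr C" "Dom C (FArr M (dclass Q d)) = FObj M (ddom Q d)"
    "Cod C (FArr M (dclass Q d)) = FObj M (dcod Q d)"
  using HomD[OF arr_hom[OF assms]] by auto

lemma gen_simps [simp]:
  assumes "q \<in> queries Q"
  shows "FArr M (gen Q q) \<in> Arr C" "Dom C (FArr M (gen Q q)) = FObj M (qin Q q)"
    "Cod C (FArr M (gen Q q)) = FObj M (qout Q q)"
  using HomD[OF arr_hom[of "DGen q"]] assms by (auto simp: gen_def)

lemma plug_hom:
  assumes "q \<in> queries Q" "sharp_state C (FObj M (nths (qin Q q) (Z q))) s"
  shows "plug C Q M Z (q, s) \<in> Hom C (FObj M (nths (qin Q q) (- Z q))) (FObj M (qout Q q))"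
proof -
  have "dwf Q (unshuffle (qin Q q) (Z q))" "ddom Q (unshuffle (qin Q q) (Z q)) =
      nths (qin Q q) (- Z q) @ nths (qin Q q) (Z q)" "dcod Q (unshuffle (qin Q q) (Z q)) = qin Q q"
    using unshuffle_types[OF query_types(1)[OF assms(1)]] by auto
  then show ?thesis
    using assms sharp_stateD[OF assms(2)] by (simp add: plug_def Let_def Hom_def)
qed

lemma sh_sig_signature: "query_signature (sh_sig C Q M Z)"
  using sig set_nths_subset by (fastforce simp: query_signature_def sh_sig_def)

lemma sh_sig_simps:
  "qtypes (sh_sig C Q M Z) = qtypes Q"
  "(q, s) \<in> queries (sh_sig C Q M Z) \<longleftrightarrow> q \<in> queries Q \<and> sharp_state C (FObj M (nths (qin Q q) (Z q))) s"
  "qin (sh_sig C Q M Z) (q, s) = nths (qin Q q) (- Z q)"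
  "qout (sh_sig C Q M Z) (q, s) = qout Q q"
  by (simp_all add: sh_sig_def)

lemma plug_sh_hom:
  "r \<in> queries (sh_sig C Q M Z) \<Longrightarrow>
    plug C Q M Z r \<in> Hom C (FObj M (qin (sh_sig C Q M Z) r)) (FObj M (qout (sh_sig C Q M Z) r))"
  using plug_hom by (cases r) (simp add: sh_sig_simps)

lemma sh_model_simps:
  "FObj (sh_model C Q M Z) = FObj M" "FMult (sh_model C Q M Z) = FMult M" "FUnit (sh_model C Q M Z) = FUnit M"
  by (simp_all add: sh_model_def)

lemma model_sh_model: "model C (sh_sig C Q M Z) (sh_model C Q M Z)"
  unfolding model_def sh_model_def
  by (intro conjI sh_sig_signature value_functor plug_sh_hom) (simp add: sh_sig_simps)

text \<open>Not immediate, since \<open>drep\<close> may return another diagram of the class of the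
  generator; by \<open>val_drep\<close> its value is the same.\<close>

lemma sh_model_gen:
  assumes "r \<in> queries (sh_sig C Q M Z)"
  shows "FArr (sh_model C Q M Z) (gen (sh_sig C Q M Z) r) = plug C Q M Z r"
  using val_drep[OF sh_sig_signature sh_sig_simps(1) plug_sh_hom, of Z "DGen r"] assms
  by (simp add: sh_model_def gen_def)

end


section \<open>Downward abstractions\<close>

locale downward = L: query_model C QL L + H: query_model C QH H
  for C :: "('o, 'm) markov_cat" (structure)
    and QL :: "('u, 'r) qsig" and L :: "('u, 'r, 'o, 'm) qmodel"
    and QH :: "('t, 'q) qsig" and H :: "('t, 'q, 'o, 'm) qmodel" +
  fixes \<pi> :: "('t, 'q, 'u list, ('u, 'r) diag set) qmodel"
    and \<kappa> :: "'q \<Rightarrow> 'r" and \<tau> :: "'t list \<Rightarrow> 'm"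
  assumes down: "downward_abstraction C QL L QH H \<pi> \<kappa> \<tau>"
begin

sublocale P: markov_functor "free_markov QH" "free_markov QL" \<pi>
  using down by (simp add: downward_abstraction_def)

abbreviation "p \<equiv> type_part (FObj \<pi>)"

lemma strict:
  assumes "xs \<in> H.T" "ys \<in> H.T"
  shows "FObj \<pi> (xs @ ys) = FObj \<pi> xs @ FObj \<pi> ys"
    "FMult \<pi> xs ys = dclass QL (DId (FObj \<pi> xs @ FObj \<pi> ys))"
    "FObj \<pi> [] = []" "FUnit \<pi> = dclass QL (DId [])"
  using down assms by (auto simp: downward_abstraction_def free_markov_simps[OF L.sig])

lemma obj_lists [simp]: "xs \<in> H.T \<Longrightarrow> FObj \<pi> xs \<in> L.T"
  using P.f_obj[of xs] by (simp add: free_markov_simps[OF H.sig] free_markov_simps[OF L.sig])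

text \<open>Strictness of \<pi> makes its action on lists the concatenation that type alignments and
  \<open>block_positions\<close> are stated with.\<close>

lemma concat_types:
  assumes "xs \<in> H.T"
  shows "concat (map p xs) = FObj \<pi> xs"
  using assms
proof (induction xs rule: list.induct)
  case Nil
  then show ?case using strict(3)[of "[]" "[]"] by simp
next
  case (Cons x xs)
  then show ?case
    using strict(1)[of "[x]" xs] by (simp add: type_part_def)
qed

lemma arr_hom:
  "dwf QH d \<Longrightarrow> FArr \<pi> (dclass QH d) \<in> Hom (free_markov QL) (FObj \<pi> (ddom QH d)) (FObj \<pi> (dcod QH d))"
  by (intro P.f_hom free_markov_HomI[OF H.sig]) auto

text \<open>Together with \<open>free_ident_right\<close> this removes the identities
  \<open>FMult \<pi>\<close> from the functor laws of \<pi>.\<close>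

lemma free_ident_left:
  assumes "f \<in> Hom (free_markov QL) xs ys"
  shows "Comp (free_markov QL) (dclass QL (DId ys)) f = f"
proof -
  obtain d where d: "f = dclass QL d" "dwf QL d" "ddom QL d = xs" "dcod QL d = ys"
    using assms by (rule free_markov_HomE[OF L.sig])
  have "deq QL (DComp (DId ys) d) d"
    using deq.id_left[OF d(2)] d(4) by simp
  then have "dclass QL (DComp (DId ys) d) = dclass QL d"
    by (rule dclass_eqI)
  then show ?thesis
    using d dwf_lists[OF L.sig d(2)] by (simp add: free_markov_comp[OF L.sig])
qed

lemma free_ident_right:
  assumes "f \<in> Hom (free_markov QL) xs ys"
  shows "Comp (free_markov QL) f (dclass QL (DId xs)) = f"
proof -
  obtain d where d: "f = dclass QL d" "dwf QL d" "ddom QL d = xs" "dcod QL d = ys"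
    using assms by (rule free_markov_HomE[OF L.sig])
  have "deq QL (DComp d (DId xs)) d"
    using deq.id_right[OF d(2)] d(3) by simp
  then have "dclass QL (DComp d (DId xs)) = dclass QL d"
    by (rule dclass_eqI)
  then show ?thesis
    using d dwf_lists[OF L.sig d(2)] by (simp add: free_markov_comp[OF L.sig])
qed

lemma arr_id: "xs \<in> H.T \<Longrightarrow> FArr \<pi> (dclass QH (DId xs)) = dclass QL (DId (FObj \<pi> xs))"
  using P.f_id[of xs] by (simp add: free_markov_simps[OF H.sig] free_markov_simps[OF L.sig])

text \<open>Phrased with explicit diagrams on both sides, so that the image of a composite diagram
  can be computed constructor by constructor.\<close>

lemma arr_comp:
  assumes "dwf QH (DComp g f)" "FArr \<pi> (dclass QH g) = dclass QL g'" "FArr \<pi> (dclass QH f) = dclass QL f'"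
    "dwf QL (DComp g' f')"
  shows "FArr \<pi> (dclass QH (DComp g f)) = dclass QL (DComp g' f')"
proof -
  have "FArr \<pi> (Comp (free_markov QH) (dclass QH g) (dclass QH f)) =
      Comp (free_markov QL) (FArr \<pi> (dclass QH g)) (FArr \<pi> (dclass QH f))"
    by (rule P.f_comp[OF free_markov_HomI[OF H.sig, OF _ HOL.refl HOL.refl] free_markov_HomI[OF H.sig]])
      (use assms(1) in auto)
  then show ?thesis
    using assms by (simp add: free_markov_comp[OF H.sig] free_markov_comp[OF L.sig])
qed

text \<open>Naturality of \<open>FMult \<pi>\<close>, whose components are identities, is exactly
  strict preservation of tensors of arrows.\<close>

lemma arr_tens:
  assumes "dwf QH f" "dwf QH g" "FArr \<pi> (dclass QH f) = dclass QL f'" "FArr \<pi> (dclass QH g) = dclass QL g'"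
    "dwf QL f'" "dwf QL g'"
  shows "FArr \<pi> (dclass QH (DTens f g)) = dclass QL (DTens f' g')"
proof -
  note T = dwf_lists[OF H.sig assms(1)] dwf_lists[OF H.sig assms(2)]
  have types: "ddom QL f' = FObj \<pi> (ddom QH f)" "dcod QL f' = FObj \<pi> (dcod QH f)"
    "ddom QL g' = FObj \<pi> (ddom QH g)" "dcod QL g' = FObj \<pi> (dcod QH g)"
    using HomD[OF arr_hom[OF assms(1)]] HomD[OF arr_hom[OF assms(2)]] assms
      free_markov_types[OF L.sig assms(5)] free_markov_types[OF L.sig assms(6)] by auto
  have hom: "dclass QL (DTens f' g') \<in> Hom (free_markov QL)
      (FObj \<pi> (ddom QH f) @ FObj \<pi> (ddom QH g)) (FObj \<pi> (dcod QH f) @ FObj \<pi> (dcod QH g))"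
    using assms types by (intro free_markov_HomI[OF L.sig]) auto
  have hom': "FArr \<pi> (dclass QH (DTens f g)) \<in> Hom (free_markov QL)
      (FObj \<pi> (ddom QH f) @ FObj \<pi> (ddom QH g)) (FObj \<pi> (dcod QH f) @ FObj \<pi> (dcod QH g))"
    using arr_hom[of "DTens f g"] assms(1,2) T strict(1) by simp
  have "Comp (free_markov QL) (FArr \<pi> (dclass QH (DTens f g))) (FMult \<pi> (ddom QH f) (ddom QH g)) =
      Comp (free_markov QL) (FMult \<pi> (dcod QH f) (dcod QH g)) (dclass QL (DTens f' g'))"
    using P.mult_natural[OF free_markov_HomI[OF H.sig, OF assms(1) HOL.refl HOL.refl]
        free_markov_HomI[OF H.sig, OF assms(2) HOL.refl HOL.refl]] assms
    by (simp add: free_markov_tens[OF H.sig] free_markov_tens[OF L.sig])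
  then show ?thesis
    using T by (simp add: strict(2) free_ident_left[OF hom] free_ident_right[OF hom'])
qed

lemma arr_swap:
  assumes "xs \<in> H.T" "ys \<in> H.T"
  shows "FArr \<pi> (dclass QH (DSwap xs ys)) = dclass QL (DSwap (FObj \<pi> xs) (FObj \<pi> ys))"
proof -
  have hom: "dclass QL (DSwap (FObj \<pi> xs) (FObj \<pi> ys)) \<in> Hom (free_markov QL)
      (FObj \<pi> xs @ FObj \<pi> ys) (FObj \<pi> ys @ FObj \<pi> xs)"
    using obj_lists assms by (intro free_markov_HomI[OF L.sig]) auto
  have hom': "FArr \<pi> (dclass QH (DSwap xs ys)) \<in> Hom (free_markov QL)
      (FObj \<pi> xs @ FObj \<pi> ys) (FObj \<pi> ys @ FObj \<pi> xs)"
    using arr_hom[of "DSwap xs ys"] assms strict(1) by simp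
  show ?thesis
    using P.mult_swap[of xs ys] assms
    by (simp add: free_markov_simps[OF H.sig] free_markov_simps[OF L.sig] strict(2)
        free_ident_left[OF hom] free_ident_right[OF hom'])
qed

text \<open>One step of \<open>unshuffle\<close> over \<open>QH\<close> concerns a wire
  \<open>x\<close>, whose image is the block \<open>FObj \<pi> [x]\<close>. The two append lemmas
  describe \<open>unshuffle\<close> over \<open>QL\<close> in steps of such blocks, so the
  recursions agree.\<close>

lemma arr_unshuffle:
  assumes "xs \<in> H.T"
  shows "FArr \<pi> (dclass QH (unshuffle xs Z)) = dclass QL (unshuffle (FObj \<pi> xs) (block_positions p xs Z))"
  using assms
proof (induction xs arbitrary: Z rule: list.induct)
  case Nil
  then show ?case
    using arr_id[of "[]"] strict(3)[of "[]" "[]"] by simp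
next
  case (Cons x xs)
  let ?Z = "{i. Suc i \<in> Z}" and ?W = "block_positions p (x # xs) Z"
  let ?W' = "block_positions p xs ?Z"
  have T: "xs \<in> H.T" "[x] \<in> H.T"
    using Cons.prems by auto
  have cons: "FObj \<pi> (x # xs) = FObj \<pi> [x] @ FObj \<pi> xs"
    using strict(1)[OF T(2,1)] by simp
  note IH = Cons.IH[OF T(1), of ?Z]
  note lists = obj_lists[OF T(1)] obj_lists[OF T(2)]
  note u = unshuffle_types[OF T(1), of ?Z] and u' = unshuffle_types[OF lists(1), of ?W']
  have W': "{i. i + length (FObj \<pi> [x]) \<in> ?W} = ?W'"
    using block_positions_Cons_shift[of p x xs Z] by (simp add: type_part_def)
  have nths: "FObj \<pi> (nths xs A) = concat (map p (nths xs A))" for A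
    by (rule concat_types[symmetric]) (use H.nths_T[OF T(1)] in simp)
  have A: "nths (FObj \<pi> xs) (- ?W') = FObj \<pi> (nths xs (- ?Z))" "nths (FObj \<pi> xs) ?W' = FObj \<pi> (nths xs ?Z)"
    unfolding nths concat_types[OF T(1), symmetric]
    by (rule nths_Compl_block_positions nths_block_positions)+
  have lT: "nths xs A \<in> H.T" "FObj \<pi> (nths xs A) \<in> L.T" for A
    using H.nths_T[OF T(1), of A] obj_lists by auto
  show ?case
  proof (cases "0 \<in> Z")
    case True
    have "{..<length (FObj \<pi> [x])} \<subseteq> ?W"
      using True block_positions_Cons_head[of p x xs Z] by (auto simp: type_part_def)
    from unshuffle_append_inside[OF lists(2,1) this W'[symmetric]]
    have deq: "deq QL (unshuffle (FObj \<pi> (x # xs)) ?W)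
        (DComp (DTens (DId (FObj \<pi> [x])) (unshuffle (FObj \<pi> xs) ?W'))
          (DTens (DSwap (FObj \<pi> (nths xs (- ?Z))) (FObj \<pi> [x])) (DId (FObj \<pi> (nths xs ?Z)))))"
      by (simp add: cons A)
    have "FArr \<pi> (dclass QH (DComp (DTens (DId [x]) (unshuffle xs ?Z))
        (DTens (DSwap (nths xs (- ?Z)) [x]) (DId (nths xs ?Z))))) =
      dclass QL (DComp (DTens (DId (FObj \<pi> [x])) (unshuffle (FObj \<pi> xs) ?W'))
          (DTens (DSwap (FObj \<pi> (nths xs (- ?Z))) (FObj \<pi> [x])) (DId (FObj \<pi> (nths xs ?Z)))))"
      by (intro arr_comp arr_tens arr_id arr_swap IH) (use T lists lT u u' A in auto)
    also have "\<dots> = dclass QL (unshuffle (FObj \<pi> (x # xs)) ?W)"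
      by (rule dclass_eqI[OF deq, symmetric])
    finally show ?thesis
      using True by (simp add: Let_def)
  next
    case False
    have "{..<length (FObj \<pi> [x])} \<inter> ?W = {}"
      using False block_positions_Cons_head[of p x xs Z] by (auto simp: type_part_def)
    from unshuffle_append_outside[OF lists(2,1) this]
    have deq: "deq QL (unshuffle (FObj \<pi> (x # xs)) ?W) (DTens (DId (FObj \<pi> [x])) (unshuffle (FObj \<pi> xs) ?W'))"
      by (simp add: cons W')
    have "FArr \<pi> (dclass QH (DTens (DId [x]) (unshuffle xs ?Z))) =
        dclass QL (DTens (DId (FObj \<pi> [x])) (unshuffle (FObj \<pi> xs) ?W'))"
      by (intro arr_tens arr_id IH) (use T lists u u' in auto)
    also have "\<dots> = dclass QL (unshuffle (FObj \<pi> (x # xs)) ?W)"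
      by (rule dclass_eqI[OF deq, symmetric])
    finally show ?thesis
      using False by (simp add: Let_def)
  qed
qed

lemma transformation:
  "markov_transformation (free_markov QH) C (functor_comp C L \<pi>) H \<tau>"
  and component_epic: "xs \<in> H.T \<Longrightarrow> epic C (\<tau> xs)"
  using down by (auto simp: downward_abstraction_def epic_transformation_def free_markov_simps[OF H.sig])

sublocale N: markov_transformation "free_markov QH" C "functor_comp C L \<pi>" H \<tau>
  by (rule transformation)

lemma component_simps [simp]:
  assumes "xs \<in> H.T"
  shows "\<tau> xs \<in> Arr C" "Dom C (\<tau> xs) = FObj L (FObj \<pi> xs)" "Cod C (\<tau> xs) = FObj H xs"
    "deterministic C (\<tau> xs)"
  using N.component_hom[of xs] N.component_det[of xs] assms
  by (auto simp: functor_comp_def free_markov_simps[OF H.sig] Hom_def)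

lemma component_natural:
  "dwf QH d \<Longrightarrow> \<tau> (dcod QH d) \<cdot> FArr L (FArr \<pi> (dclass QH d)) = FArr H (dclass QH d) \<cdot> \<tau> (ddom QH d)"
  using N.natural[OF free_markov_HomI[OF H.sig, OF _ HOL.refl HOL.refl], of d] by (simp add: functor_comp_def)

text \<open>In the composite functor, \<open>FMult\<close> carries an extra factor, the value under
  \<open>L\<close> of \<open>FMult \<pi>\<close>; by strictness it is an identity.\<close>

lemma component_mult:
  assumes [simp]: "xs \<in> H.T" "ys \<in> H.T"
  shows "\<tau> (xs @ ys) \<cdot> FMult L (FObj \<pi> xs) (FObj \<pi> ys) = FMult H xs ys \<cdot> (\<tau> xs \<otimes> \<tau> ys)"
proof -
  have "FObj \<pi> xs @ FObj \<pi> ys \<in> L.T"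
    using obj_lists[of xs] obj_lists[of ys] by auto
  then show ?thesis
    using N.monoidal_mult[of xs ys] obj_lists[of xs] obj_lists[of ys]
    by (simp add: functor_comp_def free_markov_simps[OF H.sig] strict(2) L.arr_id)
qed

lemma component_unit: "\<tau> [] \<cdot> FUnit L = FUnit H"
  using N.monoidal_unit strict(4)[of "[]" "[]"]
  by (simp add: functor_comp_def free_markov_simps[OF H.sig] L.arr_id)

text \<open>Monoidality, solved for \<open>\<tau> (x # xs)\<close> by inverting
  \<open>FMult L\<close>. Thus tensor products of the \<open>\<tau> [X]\<close> are components of
  \<tau>, which gives the epicness required of a type alignment.\<close>

lemma align_list_eq:
  assumes "xs \<in> H.T"
  shows "align_list C L H p (type_part \<tau>) xs = \<tau> xs"
  using assms
proof (induction xs rule: list.induct)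
  case Nil
  then show ?case
    using strict(3)[of "[]" "[]"] by (simp add: component_unit[symmetric])
next
  case (Cons x xs)
  then have T [simp]: "xs \<in> H.T" "[x] \<in> H.T" "FObj \<pi> xs \<in> L.T" "FObj \<pi> [x] \<in> L.T"
    using obj_lists[of xs] obj_lists[of "[x]"] by auto
  have "\<tau> (x # xs) = \<tau> ([x] @ xs) \<cdot> FMult L (FObj \<pi> [x]) (FObj \<pi> xs) \<cdot> Inv C (FMult L (FObj \<pi> [x]) (FObj \<pi> xs))"
    using component_simps[of "[x] @ xs"] Cons.prems strict(1)[of "[x]" xs] by simp
  also have "\<dots> = align_list C L H p (type_part \<tau>) (x # xs)"
  proof -
    have "type_part \<tau> x = \<tau> [x]" "p x = FObj \<pi> [x]"
      by (simp_all add: type_part_def)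
    then show ?thesis
      unfolding component_mult[OF T(2,1)] using Cons.prems by (simp add: Cons.IH[OF T(1)] concat_types[OF T(1)])
  qed
  finally show ?case by simp
qed

text \<open>Induction on the list: a sharp state of \<open>x # xs\<close> splits into two sharp
  states, each is lifted, and the lifts are paired again.\<close>

lemma surjective_lists:
  assumes surj: "surjective_alignment C L QH H p (type_part \<tau>)"
    and "xs \<in> H.T" "sharp_state C (FObj H xs) t"
  shows "\<exists>s. sharp_state C (FObj L (FObj \<pi> xs)) s \<and> t = \<tau> xs \<cdot> s"
  using assms(2,3)
proof (induction xs arbitrary: t rule: list.induct)
  case Nil
  \<comment> \<open>\<open>FObj H []\<close> is terminal, so it has only one state and
    \<open>FUnit L\<close> lifts it.\<close>
  have "t = \<tau> [] \<cdot> FUnit L"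
    using L.sharp_stateD[OF Nil.prems(2)] strict(3)[of "[]" "[]"]
    by (intro L.terminal_eq[OF H.terminal_empty]) auto
  moreover have "sharp_state C (FObj L (FObj \<pi> [])) (FUnit L)"
    using L.M.unit_det strict(3)[of "[]" "[]"] by (intro L.sharp_stateI) auto
  ultimately show ?case by blast
next
  case (Cons x xs)
  then have T [simp]: "xs \<in> H.T" "[x] \<in> H.T" "FObj \<pi> xs \<in> L.T" "FObj \<pi> [x] \<in> L.T"
    using obj_lists[of xs] obj_lists[of "[x]"] by auto
  have x [simp]: "x \<in> qtypes QH"
    using T(2) by simp
  note [simp] = L.sharp_stateD(1-3)[OF Cons.prems(2)]
  have cons: "FObj \<pi> (x # xs) = FObj \<pi> [x] @ FObj \<pi> xs"
    using strict(1)[OF T(2,1)] by simp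
  have det: "deterministic C (FMult H [x] xs)" "deterministic C (FMult L (FObj \<pi> [x]) (FObj \<pi> xs))"
    using Cons.prems(1) H.M.mult_det[of "[x]" xs] L.M.mult_det[of "FObj \<pi> [x]" "FObj \<pi> xs"]
    by (auto simp: free_markov_simps[OF H.sig] free_markov_simps[OF L.sig])
  \<comment> \<open>Splitting needs a state of an actual tensor product. The inverse of
    \<open>FMult\<close> is again deterministic, so the transported state stays sharp.\<close>
  let ?t = "Inv C (FMult H [x] xs) \<cdot> t"
  have "sharp_state C (FObj H [x] \<odot> FObj H xs) ?t"
    using L.sharp_state_comp[OF Cons.prems(2) L.deterministic_inv[OF H.mult_simps(1) det(1)]] by simp
  then obtain t1 t2 where t: "sharp_state C (FObj H [x]) t1" "sharp_state C (FObj H xs) t2"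
    "?t = (t1 \<otimes> t2) \<cdot> Copy C (UnitO C)"
    by (rule L.sharp_state_tensE) auto
  obtain s1 where s1: "sharp_state C (FObj L (FObj \<pi> [x])) s1" "t1 = \<tau> [x] \<cdot> s1"
    using surj t(1) x unfolding surjective_alignment_def type_part_def by blast
  obtain s2 where s2: "sharp_state C (FObj L (FObj \<pi> xs)) s2" "t2 = \<tau> xs \<cdot> s2"
    using Cons.IH[OF T(1) t(2)] by auto
  note [simp] = L.sharp_stateD(1-3)[OF s1(1)] L.sharp_stateD(1-3)[OF s2(1)]
  \<comment> \<open>The two lifts are paired and carried to the value of the concatenated list;
    \<open>component_mult\<close> compares this with the same transport along
    \<open>FMult H\<close>.\<close>
  let ?s = "FMult L (FObj \<pi> [x]) (FObj \<pi> xs) \<cdot> ((s1 \<otimes> s2) \<cdot> Copy C (UnitO C))"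
  have "sharp_state C (FObj L (FObj \<pi> (x # xs))) ?s"
    using L.sharp_state_comp[OF L.sharp_state_pair[OF s1(1) s2(1)] det(2)] cons by simp
  moreover have "t = \<tau> (x # xs) \<cdot> ?s"
  proof -
    have "t = FMult H [x] xs \<cdot> ?t"
      by simp
    also have "\<dots> = FMult H [x] xs \<cdot> (\<tau> [x] \<otimes> \<tau> xs) \<cdot> ((s1 \<otimes> s2) \<cdot> Copy C (UnitO C))"
      unfolding t(3) s1(2) s2(2) by simp
    also have "\<dots> = \<tau> ([x] @ xs) \<cdot> ?s"
      unfolding component_mult[OF T(2,1), symmetric]
      using component_simps[of "[x] @ xs"] Cons.prems cons by simp
    finally show ?thesis by simp
  qed
  ultimately show ?case by blast
qed

text \<open>Equality of \<open>FArr \<pi> (gen QH q)\<close> with the class of the generator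
  \<open>\<kappa> q\<close> forces equal \<open>Dom\<close> and \<open>Cod\<close>, and these
  determine its inputs and outputs.\<close>

lemma gen_types:
  assumes "q \<in> queries QH"
  shows "\<kappa> q \<in> queries QL" "FArr \<pi> (gen QH q) = gen QL (\<kappa> q)"
    "qin QL (\<kappa> q) = FObj \<pi> (qin QH q)" "qout QL (\<kappa> q) = FObj \<pi> (qout QH q)"
proof -
  show *: "\<kappa> q \<in> queries QL" "FArr \<pi> (gen QH q) = gen QL (\<kappa> q)"
    using down assms by (auto simp: downward_abstraction_def)
  show "qin QL (\<kappa> q) = FObj \<pi> (qin QH q)" "qout QL (\<kappa> q) = FObj \<pi> (qout QH q)"
    using HomD[OF arr_hom[of "DGen q"]] assms * free_markov_types[OF L.sig, of "DGen (\<kappa> q)"]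
    by (auto simp: gen_def)
qed

section \<open>The abstraction between the plugged signatures\<close>

context
  fixes ZL :: "'r \<Rightarrow> nat set" and ZH :: "'q \<Rightarrow> nat set"
  assumes Z: "\<And>q. q \<in> queries QH \<Longrightarrow> ZL (\<kappa> q) = block_positions p (qin QH q) (ZH q)"
begin

lemma plugged_types:
  assumes "q \<in> queries QH"
  shows "nths (qin QL (\<kappa> q)) (ZL (\<kappa> q)) = FObj \<pi> (nths (qin QH q) (ZH q))"
    "nths (qin QL (\<kappa> q)) (- ZL (\<kappa> q)) = FObj \<pi> (nths (qin QH q) (- ZH q))"
proof -
  have *: "FObj \<pi> (nths (qin QH q) A) = concat (map p (nths (qin QH q) A))" for A
    by (rule concat_types[symmetric]) (use assms in simp)
  have in_concat: "qin QL (\<kappa> q) = concat (map p (qin QH q))"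
    using gen_types(3)[OF assms] concat_types assms by simp
  show "nths (qin QL (\<kappa> q)) (ZL (\<kappa> q)) = FObj \<pi> (nths (qin QH q) (ZH q))"
    "nths (qin QL (\<kappa> q)) (- ZL (\<kappa> q)) = FObj \<pi> (nths (qin QH q) (- ZH q))"
    by (simp_all only: * Z[OF assms] in_concat nths_block_positions nths_Compl_block_positions)
qed

lemma component_plug:
  assumes q [simp]: "q \<in> queries QH" and s: "sharp_state C (FObj L (FObj \<pi> (nths (qin QH q) (ZH q)))) s"
  shows "\<tau> (qout QH q) \<cdot> plug C QL L ZL (\<kappa> q, s) =
    plug C QH H ZH (q, \<tau> (nths (qin QH q) (ZH q)) \<cdot> s) \<cdot> \<tau> (nths (qin QH q) (- ZH q))"
proof -
  let ?X = "qin QH q" and ?Y = "qout QH q" and ?I = "UnitO C"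
  let ?xs = "nths ?X (- ZH q)" and ?zs = "nths ?X (ZH q)"
  let ?u = "unshuffle ?X (ZH q) :: ('t, 'q) diag"
  note [simp] = L.sharp_stateD(1-3)[OF s]
  have T [simp]: "?X \<in> H.T" "?Y \<in> H.T" "?xs \<in> H.T" "?zs \<in> H.T" "FObj \<pi> ?X \<in> L.T" "FObj \<pi> ?Y \<in> L.T"
    "FObj \<pi> ?xs \<in> L.T" "FObj \<pi> ?zs \<in> L.T"
    by (simp_all add: H.query_types H.nths_T obj_lists del: in_lists_conv_set)
  note g = gen_types[OF q]
  note [simp] = L.gen_simps[OF g(1), unfolded g(3,4)]
  note u [simp] = unshuffle_types[OF T(1), of "ZH q"]
  have Lu [simp]: "FArr L (FArr \<pi> (dclass QH ?u)) \<in> Arr C"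
    "Dom C (FArr L (FArr \<pi> (dclass QH ?u))) = FObj L (FObj \<pi> ?xs @ FObj \<pi> ?zs)"
    "Cod C (FArr L (FArr \<pi> (dclass QH ?u))) = FObj L (FObj \<pi> ?X)"
    using HomD[OF L.M.f_hom[OF arr_hom[OF u(1)]]] u strict(1)[OF T(3,4)] by auto
  have [simp]: "?xs @ ?zs \<in> H.T" "FObj \<pi> (?xs @ ?zs) = FObj \<pi> ?xs @ FObj \<pi> ?zs"
    using T(3,4) strict(1)[OF T(3,4)] by auto
  \<comment> \<open>The permutation over \<open>QL\<close> is rewritten by
    \<open>arr_unshuffle\<close> as the image of the one over \<open>QH\<close>, so that naturality
    of \<tau> applies to it.\<close>
  have plugL: "plug C QL L ZL (\<kappa> q, s) = FArr L (gen QL (\<kappa> q)) \<cdot> (FArr L (FArr \<pi> (dclass QH ?u)) \<cdot>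
      (FMult L (FObj \<pi> ?xs) (FObj \<pi> ?zs) \<cdot> ((Ident C (FObj L (FObj \<pi> ?xs)) \<otimes> s) \<cdot> Inv C (RUnit C (FObj L (FObj \<pi> ?xs))))))"
    unfolding plug_def Let_def prod.case plugged_types[OF q]
    unfolding g(3) Z[OF q] arr_unshuffle[OF T(1)] by (rule HOL.refl)
  have "\<tau> ?Y \<cdot> FArr L (gen QL (\<kappa> q)) = FArr H (gen QH q) \<cdot> \<tau> ?X"
    using component_natural[of "DGen q"] g(2) by (simp add: gen_def)
  moreover have "\<tau> ?X \<cdot> FArr L (FArr \<pi> (dclass QH ?u)) = FArr H (dclass QH ?u) \<cdot> \<tau> (?xs @ ?zs)"
    using component_natural[OF u(1)] by simp
  moreover note component_mult[OF T(3,4)]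
  \<comment> \<open>Interchange lets \<open>\<tau> ?zs\<close> act on \<open>s\<close>, while
    \<open>\<tau> ?xs\<close> remains on the open inputs and slides through the inverse right
    unitor.\<close>
  moreover have "(\<tau> ?xs \<otimes> \<tau> ?zs) \<cdot> ((Ident C (FObj L (FObj \<pi> ?xs)) \<otimes> s) \<cdot> Inv C (RUnit C (FObj L (FObj \<pi> ?xs)))) =
      (Ident C (FObj H ?xs) \<otimes> (\<tau> ?zs \<cdot> s)) \<cdot> Inv C (RUnit C (FObj H ?xs)) \<cdot> \<tau> ?xs"
    using L.inv_runit_natural[of "\<tau> ?xs"] by simp
  ultimately have eqs: "\<tau> ?Y \<cdot> FArr L (gen QL (\<kappa> q)) = FArr H (gen QH q) \<cdot> \<tau> ?X"
    "\<tau> ?X \<cdot> FArr L (FArr \<pi> (dclass QH ?u)) = FArr H (dclass QH ?u) \<cdot> \<tau> (?xs @ ?zs)"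
    "\<tau> (?xs @ ?zs) \<cdot> FMult L (FObj \<pi> ?xs) (FObj \<pi> ?zs) = FMult H ?xs ?zs \<cdot> (\<tau> ?xs \<otimes> \<tau> ?zs)"
    "(\<tau> ?xs \<otimes> \<tau> ?zs) \<cdot> ((Ident C (FObj L (FObj \<pi> ?xs)) \<otimes> s) \<cdot> Inv C (RUnit C (FObj L (FObj \<pi> ?xs)))) =
      (Ident C (FObj H ?xs) \<otimes> (\<tau> ?zs \<cdot> s)) \<cdot> Inv C (RUnit C (FObj H ?xs)) \<cdot> \<tau> ?xs"
    by blast+
  let ?k = "(Ident C (FObj L (FObj \<pi> ?xs)) \<otimes> s) \<cdot> Inv C (RUnit C (FObj L (FObj \<pi> ?xs)))"
  let ?m = "FMult L (FObj \<pi> ?xs) (FObj \<pi> ?zs)"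
  have "\<tau> ?Y \<cdot> plug C QL L ZL (\<kappa> q, s) =
      \<tau> ?Y \<cdot> FArr L (gen QL (\<kappa> q)) \<cdot> (FArr L (FArr \<pi> (dclass QH ?u)) \<cdot> (?m \<cdot> ?k))"
    unfolding plugL by simp
  also have "\<dots> = FArr H (gen QH q) \<cdot> (\<tau> ?X \<cdot> FArr L (FArr \<pi> (dclass QH ?u)) \<cdot> (?m \<cdot> ?k))"
    unfolding eqs(1) by simp
  also have "\<dots> = FArr H (gen QH q) \<cdot> (FArr H (dclass QH ?u) \<cdot> (\<tau> (?xs @ ?zs) \<cdot> ?m \<cdot> ?k))"
    unfolding eqs(2) by simp
  also have "\<dots> = FArr H (gen QH q) \<cdot> (FArr H (dclass QH ?u) \<cdot> (FMult H ?xs ?zs \<cdot> ((\<tau> ?xs \<otimes> \<tau> ?zs) \<cdot> ?k)))"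
    unfolding eqs(3) by simp
  also have "\<dots> = plug C QH H ZH (q, \<tau> ?zs \<cdot> s) \<cdot> \<tau> ?xs"
    unfolding eqs(4) by (simp add: plug_def Let_def)
  finally show ?thesis .
qed

text \<open>An alignment depends on a model only through objects and structure isomorphisms, and
  plugging leaves these unchanged.\<close>

lemma align_list_sh_model:
  "align_list C (sh_model C QL L ZL) (sh_model C QH H ZH) \<rho> \<sigma> xs = align_list C L H \<rho> \<sigma> xs"
  by (induction xs) (simp_all only: align_list.simps L.sh_model_simps H.sh_model_simps)

lemma type_alignment_sh:
  "type_alignment C (sh_sig C QL L ZL) (sh_model C QL L ZL) (sh_sig C QH H ZH) (sh_model C QH H ZH) p (type_part \<tau>)"
  unfolding type_alignment_def align_list_sh_model L.sh_sig_simps H.sh_sig_simps L.sh_model_simps H.sh_model_simps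
proof (intro conjI ballI L.model_sh_model H.model_sh_model)
  fix X assume "X \<in> qtypes QH"
  then have X: "[X] \<in> H.T" by simp
  show "p X \<in> L.T"
    using obj_lists[OF X] by (simp add: type_part_def)
  show "type_part \<tau> X \<in> Hom C (FObj L (p X)) (FObj H [X])" "deterministic C (type_part \<tau> X)"
    "epic C (type_part \<tau> X)"
    unfolding type_part_def by (intro HomI component_simps[OF X] component_epic[OF X])+
next
  fix xs assume "xs \<in> H.T"
  then show "epic C (align_list C L H p (type_part \<tau>) xs)"
    using component_epic align_list_eq by simp
qed

lemma upward_abstraction_sh:
  assumes surj: "surjective_alignment C L QH H p (type_part \<tau>)"
    and graph: "Map.graph \<omega> = sh_graph C L QH ZH \<pi> \<kappa> \<tau>"
  shows "upward_abstraction C (sh_sig C QL L ZL) (sh_model C QL L ZL) (sh_sig C QH H ZH) (sh_model C QH H ZH)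
    p (type_part \<tau>) \<omega>"
proof -
  have \<omega>: "\<omega> r = Some x \<longleftrightarrow> (\<exists>q s. q \<in> queries QH \<and> sharp_state C (FObj L (FObj \<pi> (nths (qin QH q) (ZH q)))) s \<and>
      r = (\<kappa> q, s) \<and> x = (q, \<tau> (nths (qin QH q) (ZH q)) \<cdot> s))" for r x
  proof -
    have "\<omega> r = Some x \<longleftrightarrow> (r, x) \<in> sh_graph C L QH ZH \<pi> \<kappa> \<tau>"
      unfolding graph[symmetric] by (auto intro: in_graphI dest: in_graphD)
    then show ?thesis
      unfolding sh_graph_def by auto
  qed
  \<comment> \<open>By \<open>plugged_types\<close> the inputs plugged in \<open>\<kappa> q\<close>
    are the image of those plugged in \<open>q\<close>; the state on the side of \<open>H\<close>
    stays sharp because \<tau> has deterministic components.\<close>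
  have low: "(\<kappa> q, s) \<in> queries (sh_sig C QL L ZL)"
    and high: "(q, \<tau> (nths (qin QH q) (ZH q)) \<cdot> s) \<in> queries (sh_sig C QH H ZH)"
    if "q \<in> queries QH" "sharp_state C (FObj L (FObj \<pi> (nths (qin QH q) (ZH q)))) s" for q s
    using that L.sharp_state_comp[OF that(2), of "\<tau> (nths (qin QH q) (ZH q))"]
    by (simp_all add: L.sh_sig_simps H.sh_sig_simps plugged_types gen_types(1)
        H.query_types H.nths_T component_simps del: in_lists_conv_set)
  have dom: "dom \<omega> \<subseteq> queries (sh_sig C QL L ZL)"
    using low by (auto simp: \<omega>)
  have ran: "ran \<omega> = queries (sh_sig C QH H ZH)"
  proof
    show "ran \<omega> \<subseteq> queries (sh_sig C QH H ZH)"
      using high by (auto simp: \<omega> ran_def)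
    show "queries (sh_sig C QH H ZH) \<subseteq> ran \<omega>"
    proof
      fix x assume x: "x \<in> queries (sh_sig C QH H ZH)"
      obtain q t where [simp]: "x = (q, t)" by fastforce
      have q: "q \<in> queries QH" and t: "sharp_state C (FObj H (nths (qin QH q) (ZH q))) t"
        using x by (auto simp: H.sh_sig_simps)
      \<comment> \<open>The hypothesis on \<tau> concerns single types, but \<open>t\<close> is a
        state of a list of inputs, so the lift comes from \<open>surjective_lists\<close>.\<close>
      obtain s where "sharp_state C (FObj L (FObj \<pi> (nths (qin QH q) (ZH q)))) s" "t = \<tau> (nths (qin QH q) (ZH q)) \<cdot> s"
        using surjective_lists[OF surj H.nths_T[OF H.query_types(1)[OF q]] t] by blast
      then have "\<omega> (\<kappa> q, s) = Some x"
        using q by (auto simp: \<omega>)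
      then show "x \<in> ran \<omega>"
        by (rule ranI)
    qed
  qed
  have commute: "\<forall>r x. \<omega> r = Some x \<longrightarrow> qin (sh_sig C QL L ZL) r = concat (map p (qin (sh_sig C QH H ZH) x)) \<and>
      qout (sh_sig C QL L ZL) r = concat (map p (qout (sh_sig C QH H ZH) x)) \<and>
      align_list C (sh_model C QL L ZL) (sh_model C QH H ZH) p (type_part \<tau>) (qout (sh_sig C QH H ZH) x) \<cdot>
        FArr (sh_model C QL L ZL) (gen (sh_sig C QL L ZL) r) =
      FArr (sh_model C QH H ZH) (gen (sh_sig C QH H ZH) x) \<cdot>
        align_list C (sh_model C QL L ZL) (sh_model C QH H ZH) p (type_part \<tau>) (qin (sh_sig C QH H ZH) x)"
  proof (intro allI impI)
    fix r x assume "\<omega> r = Some x"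
    then obtain q s where q: "q \<in> queries QH" and s: "sharp_state C (FObj L (FObj \<pi> (nths (qin QH q) (ZH q)))) s"
      and r: "r = (\<kappa> q, s)" and x: "x = (q, \<tau> (nths (qin QH q) (ZH q)) \<cdot> s)"
      using \<omega>[of r x] by blast
    have T: "qout QH q \<in> H.T" "nths (qin QH q) (- ZH q) \<in> H.T"
      using q by (simp_all add: H.query_types H.nths_T del: in_lists_conv_set)
    show "qin (sh_sig C QL L ZL) r = concat (map p (qin (sh_sig C QH H ZH) x)) \<and>
        qout (sh_sig C QL L ZL) r = concat (map p (qout (sh_sig C QH H ZH) x)) \<and>
        align_list C (sh_model C QL L ZL) (sh_model C QH H ZH) p (type_part \<tau>) (qout (sh_sig C QH H ZH) x) \<cdot>
          FArr (sh_model C QL L ZL) (gen (sh_sig C QL L ZL) r) =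
        FArr (sh_model C QH H ZH) (gen (sh_sig C QH H ZH) x) \<cdot>
          align_list C (sh_model C QL L ZL) (sh_model C QH H ZH) p (type_part \<tau>) (qin (sh_sig C QH H ZH) x)"
      unfolding r x align_list_sh_model L.sh_model_gen[OF low[OF q s]] H.sh_model_gen[OF high[OF q s]]
        L.sh_sig_simps H.sh_sig_simps align_list_eq[OF T(1)] align_list_eq[OF T(2)] component_plug[OF q s]
        concat_types[OF T(1)] concat_types[OF T(2)] plugged_types(2)[OF q] gen_types(4)[OF q]
      by simp
  qed
  show ?thesis
    unfolding upward_abstraction_def
    by (rule conjI[OF type_alignment_sh conjI[OF dom conjI[OF ran commute]]])
qed

end

end

text \<open>Single-valuedness makes the description \<open>THE b\<close> well defined on
  \<open>Domain G\<close>, and the partial map is \<open>None\<close> elsewhere.\<close>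

lemma single_valued_graphE:
  assumes "single_valued G"
  obtains f where "Map.graph f = G"
proof
  show "Map.graph (\<lambda>a. if a \<in> Domain G then Some (THE b. (a, b) \<in> G) else None) = G" (is "Map.graph ?f = G")
  proof -
    have "(THE b'. (a, b') \<in> G) = b" if "(a, b) \<in> G" for a b
      using that assms by (blast dest: single_valuedD)
    then have "?f a = Some b \<longleftrightarrow> (a, b) \<in> G" for a b
      by (auto simp: Domain_iff)
    then show ?thesis
      by (simp add: Map.graph_def)
  qed
qed

theorem proposition18:
  fixes C :: "('o, 'm) markov_cat"
    and QL :: "('u, 'r) qsig" and L :: "('u, 'r, 'o, 'm) qmodel"
    and QH :: "('t, 'q) qsig" and H :: "('t, 'q, 'o, 'm) qmodel"
    and \<pi> :: "('t, 'q, 'u list, ('u, 'r) diag set) qmodel"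
    and \<kappa> :: "'q \<Rightarrow> 'r" and \<tau> :: "'t list \<Rightarrow> 'm"
    and ZH :: "'q \<Rightarrow> nat set" and ZL :: "'r \<Rightarrow> nat set"
  assumes "markov_category C"
    and "downward_abstraction C QL L QH H \<pi> \<kappa> \<tau>"
    and "surjective_alignment C L QH H (type_part (FObj \<pi>)) (type_part \<tau>)"
    and "input_choice QH ZH"
    and "input_choice QL ZL"
    and "\<And>q. q \<in> queries QH \<Longrightarrow>
           ZL (\<kappa> q) = block_positions (type_part (FObj \<pi>)) (qin QH q) (ZH q)"
    and "single_valued (sh_graph C L QH ZH \<pi> \<kappa> \<tau>)"
  shows "\<exists>\<omega>. Map.graph \<omega> = sh_graph C L QH ZH \<pi> \<kappa> \<tau> \<and>
             upward_abstraction C (sh_sig C QL L ZL) (sh_model C QL L ZL)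
               (sh_sig C QH H ZH) (sh_model C QH H ZH)
               (type_part (FObj \<pi>)) (type_part \<tau>) \<omega>"
proof -
  interpret markov_category C by fact
  interpret downward C QL L QH H \<pi> \<kappa> \<tau>
    using assms(2) by unfold_locales (auto simp: downward_abstraction_def)
  from assms(7) obtain \<omega> where "Map.graph \<omega> = sh_graph C L QH ZH \<pi> \<kappa> \<tau>"
    by (rule single_valued_graphE)
  then show ?thesis
    using upward_abstraction_sh[OF assms(6) assms(3)] by blast
qed

end
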